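(* The number of subgroup classes of abelian groups of order at most $x$ is asymptotic, as $x\to\infty$, to $C\,x\log x$, where $C$ is a constant. That is, there is a constant $C$ with $$\sum_{n\le x}A(n)\sim C\,x\log x\qquad(x\to\infty).$$
   Context: For a finite abelian group $G$, the number of subgroup classes of $G$ is the number of isomorphism classes of groups $H$ that are isomorphic to a subgroup of $G$ (isomorphic subgroups are counted once). $A(n)$ is the sum, over isomorphism classes of abelian groups $G$ of order $n$ (of arbitrary rank), of the number of subgroup classes of $G$. *)

theory Defs
  imports Complex_Main "HOL-Algebra.Coset" "HOL-Library.Landau_Symbols"
begin

(* All groups are taken with carriers inside nat; as every finite group is isomorphic
   to one of these, the classes below represent all isomorphism types of finite groups. *)

definition iso_classes :: "nat monoid set \<Rightarrow> nat monoid set set" where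
  "iso_classes S = S // {(G, H). G \<in> S \<and> H \<in> S \<and> G \<cong> H}"

definition abelian_groups_of_order :: "nat \<Rightarrow> nat monoid set" where
  "abelian_groups_of_order n = {G. comm_group G \<and> finite (carrier G) \<and> order G = n}"

definition subgroup_classes :: "nat monoid \<Rightarrow> nat monoid set set" where
  "subgroup_classes G =
     iso_classes {H. group H \<and> (\<exists>K. subgroup K G \<and> H \<cong> G\<lparr>carrier := K\<rparr>)}"

(* The choice of representative is immaterial, see subgroup_classes_cong. *)
definition subgroup_class_total :: "nat \<Rightarrow> nat" where
  "subgroup_class_total n =
     (\<Sum>c\<in>iso_classes (abelian_groups_of_order n). card (subgroup_classes (SOME G. G \<in> c)))"

lemma equiv_iso:
  assumes "\<And>G. G \<in> S \<Longrightarrow> group G"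
  shows "equiv S {(G, H). G \<in> S \<and> H \<in> S \<and> G \<cong> H}"
proof (rule equivI)
  show "sym {(G, H). G \<in> S \<and> H \<in> S \<and> G \<cong> H}"
    using assms by (intro symI) (blast intro: group.iso_sym)
  show "trans {(G, H). G \<in> S \<and> H \<in> S \<and> G \<cong> H}"
    by (intro transI) (blast intro: iso_trans)
qed (auto intro: refl_onI)

lemma subgroup_classes_cong:
  assumes "group G" "group G'" "G \<cong> G'"
  shows "subgroup_classes G = subgroup_classes G'"
proof -
  have *: "\<exists>K'. subgroup K' G2 \<and> H \<cong> G2\<lparr>carrier := K'\<rparr>"
    if g: "group G1" "group G2" "G1 \<cong> G2" and K: "subgroup K G1" "H \<cong> G1\<lparr>carrier := K\<rparr>"
    for G1 G2 H :: "nat monoid" and K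
  proof -
    from g(3) obtain f where f: "f \<in> iso G1 G2" by (auto simp: is_iso_def)
    have "subgroup (f ` K) G2"
      using subgroup.iso_subgroup[OF K(1) g(1,2) f] .
    moreover have "K \<subseteq> carrier G1" using K(1) by (rule subgroup.subset)
    then have "f \<in> iso (G1\<lparr>carrier := K\<rparr>) (G2\<lparr>carrier := f ` K\<rparr>)"
      using f by (auto simp: iso_def hom_def bij_betw_def inj_on_def subset_iff)
    then have "H \<cong> G2\<lparr>carrier := f ` K\<rparr>"
      by (rule iso_trans[OF K(2) is_isoI])
    ultimately show ?thesis by blast
  qed
  have "G' \<cong> G" using assms by (blast intro: group.iso_sym)
  then have "(\<exists>K. subgroup K G \<and> H \<cong> G\<lparr>carrier := K\<rparr>) \<longleftrightarrow>
        (\<exists>K. subgroup K G' \<and> H \<cong> G'\<lparr>carrier := K\<rparr>)" for H :: "nat monoid"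
    by (metis *[OF assms] *[OF assms(2,1)])
  then show ?thesis by (simp only: subgroup_classes_def)
qed

end

(* The number A(n) of pairs (class of an abelian group of order n, class of one of its subgroups)
   is multiplicative, because a group of order mn with m, n coprime is the product of its m-torsion
   and its n-torsion, and so are its subgroups.  Moreover A(p) = 2, as for the divisor function d,
   and A(p^k) = O((16/9)^k) uniformly in p: splitting off a cyclic factor of maximal order gives the
   recursion of the partition function for the number of classes of order p^k, hence a bound
   O((4/3)^k).  So A is the Dirichlet convolution of d with a multiplicative g that vanishes at
   primes and satisfies sum |g(n)|/n < infinity, and the sum of A over n <= N is asymptotic to
   C N log N with C = sum g(n)/n.  As a cyclic group of order n has subgroups of every order
   dividing n, A >= d, so that C >= 1. *)

theory Submission
  imports Defs "HOL-Library.Log_Nat" "HOL-Analysis.Analysis" "HOL-Number_Theory.Number_Theory" "HOL-Real_Asymp.Real_Asymp" "HOL-Algebra.Sylow" "HOL-Algebra.Elementary_Groups"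
begin

section \<open>Dirichlet convolution\<close>

text \<open>The critical prime is 2: the geometric bound for its Euler factor requires A(2^k) to
  grow at a rate below 2. A pair of classes is estimated by choosing the two classes independently,
  which squares the growth rate of the number of classes, so that rate has to stay below the square
  root of 2. The value 4/3 meets this, because its square 16/9 is less than 2, and 3/4 lies inside
  the disc of convergence of the partition generating function. A second obstacle is that A(n) is
  given as a sum over classes with a chosen representative in each. It is first rewritten as the
  cardinality of one set of pairs of classes. Multiplicativity then becomes a bijection between such
  sets, and both the upper and the lower bounds become inclusions.\<close>

definition dirichlet_conv :: "(nat \<Rightarrow> real) \<Rightarrow> (nat \<Rightarrow> real) \<Rightarrow> nat \<Rightarrow> real" where
  "dirichlet_conv f g n = (\<Sum>d | d dvd n. f d * g (n div d))"

definition multiplicative :: "(nat \<Rightarrow> real) \<Rightarrow> bool" where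
  "multiplicative f \<longleftrightarrow> f 1 = 1 \<and>
     (\<forall>m n. m > 0 \<longrightarrow> n > 0 \<longrightarrow> coprime m n \<longrightarrow> f (m * n) = f m * f n)"

definition divisor_count :: "nat \<Rightarrow> nat" where
  "divisor_count n = card {d. d dvd n}"

lemma multiplicativeD:
  assumes "multiplicative f" "m > 0" "n > 0" "coprime m n"
  shows "f (m * n) = f m * f n"
  using assms by (auto simp: multiplicative_def)

lemma bij_betw_divisors_coprime:
  assumes "coprime m (n::nat)"
  shows "bij_betw (\<lambda>(a, b). a * b) ({a. a dvd m} \<times> {b. b dvd n}) {d. d dvd m * n}"
proof (rule bij_betwI')
  fix x y assume x: "x \<in> {a. a dvd m} \<times> {b. b dvd n}" and y: "y \<in> {a. a dvd m} \<times> {b. b dvd n}"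
  obtain a b c d where [simp]: "x = (a, b)" "y = (c, d)" by (metis surj_pair)
  have *: "a * b = c * d \<Longrightarrow> a = c \<and> b = d"
  proof -
    assume eq: "a * b = c * d"
    have "coprime a d" "coprime c b"
      using x y assms by (auto intro: coprime_divisors[of _ m _ n])
    then have "coprime b c" "coprime d a" by (simp_all add: coprime_commute)
    with \<open>coprime a d\<close> \<open>coprime c b\<close> have "a dvd c" "c dvd a" "b dvd d" "d dvd b"
      by (metis eq coprime_dvd_mult_left_iff dvd_triv_left,
        metis eq coprime_dvd_mult_left_iff dvd_triv_left,
        metis eq coprime_dvd_mult_right_iff dvd_triv_right,
        metis eq coprime_dvd_mult_right_iff dvd_triv_right)
    then show "a = c \<and> b = d" by (simp add: dvd_antisym)
  qed
  show "((case x of (a, b) \<Rightarrow> a * b) = (case y of (a, b) \<Rightarrow> a * b)) = (x = y)"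
    using * by auto
next
  fix x assume "x \<in> {a. a dvd m} \<times> {b. b dvd n}"
  then show "(case x of (a, b) \<Rightarrow> a * b) \<in> {d. d dvd m * n}" by (auto intro: mult_dvd_mono)
next
  fix y assume "y \<in> {d. d dvd m * n}"
  then obtain a b where "y = a * b" "a dvd m" "b dvd n" using division_decomp by blast
  then show "\<exists>x\<in>{a. a dvd m} \<times> {b. b dvd n}. y = (case x of (a, b) \<Rightarrow> a * b)" by auto
qed

lemma multiplicative_dirichlet_conv:
  assumes f: "multiplicative f" and g: "multiplicative g"
  shows "multiplicative (dirichlet_conv f g)"
  unfolding multiplicative_def
proof (intro conjI allI impI)
  show "dirichlet_conv f g 1 = 1"
    using f g by (simp add: dirichlet_conv_def multiplicative_def)
  fix m n :: nat assume mn: "m > 0" "n > 0" "coprime m n"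
  have "dirichlet_conv f g (m * n) =
     (\<Sum>(a, b) \<in> {a. a dvd m} \<times> {b. b dvd n}. f (a * b) * g (m * n div (a * b)))"
    unfolding dirichlet_conv_def
    by (subst sum.reindex_bij_betw[OF bij_betw_divisors_coprime[OF mn(3)], symmetric])
       (simp add: case_prod_unfold)
  also have "\<dots> = (\<Sum>(a, b) \<in> {a. a dvd m} \<times> {b. b dvd n}.
      (f a * g (m div a)) * (f b * g (n div b)))"
  proof (rule sum.cong[OF refl], clarsimp)
    fix a b assume ab: "a dvd m" "b dvd n"
    have "f (a * b) = f a * f b"
      using ab mn by (intro multiplicativeD[OF f]) (auto intro: coprime_divisors Nat.gr0I)
    moreover have "g ((m div a) * (n div b)) = g (m div a) * g (n div b)"
    proof (intro multiplicativeD[OF g])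
      show "m div a > 0" "n div b > 0" using ab mn
        by (auto simp: div_greater_zero_iff dvd_imp_le intro: Nat.gr0I)
      show "coprime (m div a) (n div b)"
        using ab mn(3) by (auto elim!: dvdE)
    qed
    ultimately show "f (a * b) * g (m * n div (a * b)) = f a * g (m div a) * (f b * g (n div b))"
      using ab by (simp add: div_mult_div_if_dvd)
  qed
  also have "\<dots> = dirichlet_conv f g m * dirichlet_conv f g n"
    by (simp add: dirichlet_conv_def sum_product sum.cartesian_product)
  finally show "dirichlet_conv f g (m * n) = dirichlet_conv f g m * dirichlet_conv f g n" .
qed

lemma multiplicative_eq_prod:
  assumes f: "multiplicative f" and n: "n > 0"
  shows "f n = (\<Prod>p\<in>prime_factors n. f (p ^ multiplicity p n))"
proof -
  \<comment> \<open>The set of primes and the exponents are arbitrary, since the statement for the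
    prime factors of a fixed \<open>n\<close> would not support an induction.\<close>
  have "f (\<Prod>p\<in>S. p ^ e p) = (\<Prod>p\<in>S. f (p ^ e p))"
    if "finite S" "\<forall>p\<in>S. prime p" for S and e :: "nat \<Rightarrow> nat"
    using that
  proof (induction S rule: finite_induct)
    case empty
    then show ?case using f by (simp add: multiplicative_def)
  next
    case (insert p S)
    have "coprime (p ^ e p) (\<Prod>q\<in>S. q ^ e q)"
      using insert by (intro prod_coprime_right) (auto intro!: primes_coprime)
    then have "f (p ^ e p * (\<Prod>q\<in>S. q ^ e q)) = f (p ^ e p) * f (\<Prod>q\<in>S. q ^ e q)"
      using insert by (intro multiplicativeD[OF f]) (auto intro!: prod_pos prime_gt_0_nat)
    then show ?case using insert by simp
  qed
  from this[of "prime_factors n" "\<lambda>p. multiplicity p n"] show ?thesis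
    using n by (simp add: prime_factorization_nat[symmetric] in_prime_factors_imp_prime)
qed

section \<open>Division of a multiplicative function by the divisor function\<close>

definition mult_extension :: "(nat \<Rightarrow> nat \<Rightarrow> real) \<Rightarrow> nat \<Rightarrow> real" where
  "mult_extension h n = (\<Prod>p\<in>prime_factors n. h p (multiplicity p n))"

lemma multiplicative_mult_extension: "multiplicative (mult_extension h)"
  unfolding multiplicative_def
proof (intro conjI allI impI)
  show "mult_extension h 1 = 1" by (simp add: mult_extension_def)
  fix m n :: nat assume mn: "m > 0" "n > 0" "coprime m n"
  have "prime_factors m \<inter> prime_factors n = {}"
    using mn by (metis (no_types, lifting) coprime_common_divisor disjoint_iff in_prime_factors_iff not_prime_unit)
  moreover have "multiplicity p (m * n) = multiplicity p m" if "p \<in> prime_factors m" for p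
    using that mn
    by (subst prime_elem_multiplicity_mult_distrib)
       (auto simp: in_prime_factors_iff intro!: not_dvd_imp_multiplicity_0 dest: coprime_common_divisor[of m n p])
  moreover have "multiplicity p (m * n) = multiplicity p n" if "p \<in> prime_factors n" for p
    using that mn
    by (subst prime_elem_multiplicity_mult_distrib)
       (auto simp: in_prime_factors_iff intro!: not_dvd_imp_multiplicity_0 dest: coprime_common_divisor[of m n p])
  ultimately show "mult_extension h (m * n) = mult_extension h m * mult_extension h n"
    using mn by (simp add: mult_extension_def prime_factors_product prod.union_disjoint)
qed

lemma mult_extension_prime_power:
  assumes "prime p" "h p 0 = 1"
  shows "mult_extension h (p ^ k) = h p k"
  using assms
  by (cases "k = 0") (auto simp: mult_extension_def prime_factorization_prime_power prime_elem_multiplicity_eq_zero_iff multiplicity_prime_power)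

lemma divisors_prime_power: "prime (p::nat) \<Longrightarrow> {d. d dvd p ^ k} = (\<lambda>i. p ^ i) ` {..k}"
  by (auto simp: divides_primepow_nat)

lemma dirichlet_conv_prime_power:
  assumes "prime p"
  shows "dirichlet_conv f g (p ^ k) = (\<Sum>i\<le>k. f (p ^ i) * g (p ^ (k - i)))"
proof -
  have "inj_on (\<lambda>i. p ^ i) {..k}" using prime_gt_1_nat[OF assms] by (auto simp: inj_on_def)
  then show ?thesis using prime_gt_0_nat[OF assms]
    by (simp add: dirichlet_conv_def divisors_prime_power[OF assms] sum.reindex power_diff)
qed

lemma divisor_count_eq_conv: "real (divisor_count n) = dirichlet_conv (\<lambda>_. 1) (\<lambda>_. 1) n"
  by (simp add: divisor_count_def dirichlet_conv_def)

lemma multiplicative_divisor_count: "multiplicative (\<lambda>n. real (divisor_count n))"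
  unfolding divisor_count_eq_conv
  by (rule multiplicative_dirichlet_conv) (auto simp: multiplicative_def)

lemma divisor_count_prime_power: "prime p \<Longrightarrow> real (divisor_count (p ^ k)) = real k + 1"
  by (simp add: divisor_count_eq_conv dirichlet_conv_prime_power)

text \<open>At each prime this multiplies the power series with coefficients
  \<open>a (p ^ k)\<close> by (1 - t)^2, the inverse of the series 1 + 2t + 3t^2 + ... of the
  divisor function. The exponents 0 and 1 are listed apart, with \<open>a 1 = 1\<close> built in,
  because \<open>k - 1\<close> and \<open>k - 2\<close> truncate there.\<close>

definition conv_quotient :: "(nat \<Rightarrow> real) \<Rightarrow> nat \<Rightarrow> real" where
  "conv_quotient a = mult_extension (\<lambda>p k. if k = 0 then 1 else
     if k = 1 then a p - 2 else a (p ^ k) - 2 * a (p ^ (k - 1)) + a (p ^ (k - 2)))"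

text \<open>Convolution with 1, 2, 3, ... is summation carried out twice, which undoes a second
  difference: the first summation telescopes to \<open>u k - u (k - 1)\<close>, the second to
  \<open>u k\<close>.\<close>

lemma second_difference_sum:
  fixes u :: "nat \<Rightarrow> real"
  assumes "u 0 = 1"
  shows "(\<Sum>i\<le>k. (if i = 0 then 1 else if i = 1 then u 1 - 2 else u i - 2 * u (i - 1) + u (i - 2))
            * (real (k - i) + 1)) = u k"
proof -
  define w where "w i = (if i = 0 then 1 else if i = 1 then u 1 - 2 else u i - 2 * u (i - 1) + u (i - 2))" for i
  have S: "(\<Sum>i\<le>k. w i) = (if k = 0 then 1 else u k - u (k - 1))" for k
  proof (induction k)
    case (Suc k)
    then show ?case using assms by (cases k) (auto simp: w_def)
  qed (simp add: w_def)
  have "(\<Sum>i\<le>k. w i * (real (k - i) + 1)) = u k"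
  proof (induction k)
    case 0 show ?case using assms by (simp add: w_def)
  next
    case (Suc k)
    have "(\<Sum>i\<le>Suc k. w i * (real (Suc k - i) + 1)) = (\<Sum>i\<le>k. w i * (real (Suc k - i) + 1)) + w (Suc k)" by simp
    \<comment> \<open>Raising every weight by one adds each \<open>w i\<close> once more; together
      with \<open>w (Suc k)\<close> this is one partial sum as evaluated in
      \<open>S\<close>.\<close>
    also have "(\<Sum>i\<le>k. w i * (real (Suc k - i) + 1)) = (\<Sum>i\<le>k. w i * (real (k - i) + 1) + w i)"
      by (rule sum.cong) (auto simp: Suc_diff_le algebra_simps)
    also have "\<dots> + w (Suc k) = u k + (\<Sum>i\<le>Suc k. w i)" using Suc by (simp add: sum.distrib)
    finally show ?case unfolding S by simp
  qed
  then show ?thesis by (simp add: w_def)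
qed

text \<open>Both sides are multiplicative, so it suffices to compare them at prime powers, where the
  identity is the one for second differences.\<close>

lemma conv_quotient_divisor_count:
  assumes a: "multiplicative a" and n: "n > 0"
  shows "dirichlet_conv (conv_quotient a) (\<lambda>n. real (divisor_count n)) n = a n"
proof -
  have m: "multiplicative (dirichlet_conv (conv_quotient a) (\<lambda>n. real (divisor_count n)))"
    unfolding conv_quotient_def
    by (intro multiplicative_dirichlet_conv multiplicative_mult_extension multiplicative_divisor_count)
  have "dirichlet_conv (conv_quotient a) (\<lambda>n. real (divisor_count n)) (p ^ k) = a (p ^ k)"
    if p: "prime p" for p k
    using second_difference_sum[of "\<lambda>k. a (p ^ k)" k] a
    by (simp add: dirichlet_conv_prime_power[OF p] divisor_count_prime_power[OF p] conv_quotient_def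
      mult_extension_prime_power[OF p] multiplicative_def cong: if_cong)
  then show ?thesis
    by (simp add: multiplicative_eq_prod[OF m n] multiplicative_eq_prod[OF a n] in_prime_factors_imp_prime cong: prod.cong)
qed

lemma conv_quotient_prime_power:
  "prime p \<Longrightarrow> conv_quotient a (p ^ k) = (if k = 0 then 1 else
     if k = 1 then a p - 2 else a (p ^ k) - 2 * a (p ^ (k - 1)) + a (p ^ (k - 2)))"
  by (simp add: conv_quotient_def mult_extension_prime_power)

lemma multiplicative_conv_quotient: "multiplicative (conv_quotient a)"
  by (simp add: conv_quotient_def multiplicative_mult_extension)

section \<open>Summatory functions of multiplicative functions\<close>

text \<open>By unique factorisation the expanded product contains each such \<open>n\<close> once,
  together with further nonnegative terms that are dropped. Truncation at \<open>N\<close> keeps all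
  sums finite, so the estimate is available before any convergence is known.\<close>

lemma sum_smooth_le_prod:
  fixes h :: "nat \<Rightarrow> real"
  assumes h: "multiplicative h" "\<And>n. h n \<ge> 0" and F: "finite F" "\<And>p. p \<in> F \<Longrightarrow> prime p"
  shows "(\<Sum>n | n \<in> {1..N} \<and> prime_factors n \<subseteq> F. h n) \<le> (\<Prod>p\<in>F. \<Sum>k\<le>N. h (p ^ k))"
  using F
proof (induction F rule: finite_induct)
  case empty
  have "{n. n \<in> {1..N} \<and> prime_factors n \<subseteq> {}} \<subseteq> {1}"
    by (auto simp: prime_factorization_empty_iff)
  then have "(\<Sum>n | n \<in> {1..N} \<and> prime_factors n \<subseteq> {}. h n) \<le> (\<Sum>n\<in>{1}. h n)"
    using h(2) by (intro sum_mono2) auto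
  then show ?case using h(1) by (simp add: multiplicative_def)
next
  case (insert p F)
  define S where "S F = {n. n \<in> {1..N} \<and> prime_factors n \<subseteq> F}" for F
  have fin: "finite (S F)" for F by (simp add: S_def)
  have p: "prime p" using insert by auto
  \<comment> \<open>The p-adic valuation and the cofactor prime to \<open>p\<close>; the induction
    peels off one prime at a time.\<close>
  define \<phi> where "\<phi> n = (multiplicity p n, n div p ^ multiplicity p n)" for n
  have dec: "n = p ^ fst (\<phi> n) * snd (\<phi> n)" for n
    by (simp add: \<phi>_def multiplicity_dvd)
  have inj: "inj_on \<phi> (S (insert p F))"
    by (rule inj_onI) (metis dec)
  have props: "\<phi> n \<in> {..N} \<times> S F \<and> coprime (p ^ fst (\<phi> n)) (snd (\<phi> n)) \<and> snd (\<phi> n) > 0" if n: "n \<in> S (insert p F)" for n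
  proof -
    have n0: "n > 0" "n \<le> N" using n by (auto simp: S_def)
    have c: "coprime p (n div p ^ multiplicity p n)"
      using p n0 by (metis multiplicity_decompose not_prime_unit prime_imp_coprime_nat not_gr_zero)
    have "p ^ multiplicity p n \<le> n" using n0 by (intro dvd_imp_le multiplicity_dvd)
    \<comment> \<open>This is why the cutoff \<open>k \<le> N\<close> covers all exponents that
      occur: k < p^k \<le> n \<le> N.\<close>
    moreover have "multiplicity p n < p ^ multiplicity p n"
      using prime_gt_1_nat[OF p] by (intro power_gt_expt) auto
    ultimately have "multiplicity p n \<le> N" using n0 by linarith
    moreover have pos: "n div p ^ multiplicity p n > 0"
      using n0 by (metis dec \<phi>_def mult_0_right not_gr_zero snd_conv)
    moreover have "n div p ^ multiplicity p n \<le> N" using n0 by (meson div_le_dividend le_trans)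
    moreover have "prime_factors (n div p ^ multiplicity p n) \<subseteq> F"
    proof
      fix q assume q: "q \<in> prime_factors (n div p ^ multiplicity p n)"
      have "q \<in> prime_factors n"
        using q n0 by (metis dec \<phi>_def dvd_mult in_prime_factors_iff snd_conv not_gr_zero)
      then have "q \<in> insert p F" using n by (auto simp: S_def)
      moreover have "q \<noteq> p" using q c p by (metis coprime_absorb_left in_prime_factors_iff not_prime_unit)
      ultimately show "q \<in> F" by auto
    qed
    ultimately show ?thesis using c by (auto simp: \<phi>_def S_def)
  qed
  have "(\<Sum>n\<in>S (insert p F). h n) = (\<Sum>n\<in>S (insert p F). (\<lambda>(k, m). h (p ^ k) * h m) (\<phi> n))"
  proof (rule sum.cong[OF refl])
    fix n assume "n \<in> S (insert p F)"
    note pr = props[OF this]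
    have "h n = h (p ^ fst (\<phi> n) * snd (\<phi> n))" using dec[of n] by simp
    also have "\<dots> = h (p ^ fst (\<phi> n)) * h (snd (\<phi> n))"
      using pr p by (intro multiplicativeD[OF h(1)]) (auto simp: prime_gt_0_nat)
    finally show "h n = (\<lambda>(k, m). h (p ^ k) * h m) (\<phi> n)" by (simp add: case_prod_unfold)
  qed
  also have "\<dots> = (\<Sum>(k, m)\<in>\<phi> ` S (insert p F). h (p ^ k) * h m)"
    by (subst sum.reindex[OF inj]) simp
  also have "\<dots> \<le> (\<Sum>(k, m)\<in>{..N} \<times> S F. h (p ^ k) * h m)"
    using props h(2) fin by (intro sum_mono2) (auto simp: image_subset_iff)
  also have "\<dots> = (\<Sum>k\<le>N. h (p ^ k)) * (\<Sum>m\<in>S F. h m)"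
    by (simp add: sum_product sum.cartesian_product)
  also have "\<dots> \<le> (\<Sum>k\<le>N. h (p ^ k)) * (\<Prod>p\<in>F. \<Sum>k\<le>N. h (p ^ k))"
    using insert h(2) by (intro mult_left_mono sum_nonneg) (auto simp: S_def)
  finally show ?case using insert by (simp add: S_def)
qed

text \<open>The hypothesis \<open>a p = 2\<close> removes the term \<open>k = 1\<close>, so the tail
  begins at \<open>k = 2\<close> and has order 1/p^2. A second difference costs the factor 1 + 2 + 1
  = 4. The ratio 16/(9p) is at most 8/9 even at p = 2, which bounds the geometric series by 9.
  Altogether 4 * 9 * (16/9)^2 = 1024/9, rounded up to 128.\<close>

lemma conv_quotient_euler_factor:
  fixes a :: "nat \<Rightarrow> real"
  assumes p: "prime (p::nat)" and ap: "a p = 2" and B: "\<And>k. \<bar>a (p ^ k)\<bar> \<le> B * (16/9) ^ k"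
  shows "(\<Sum>k\<le>N. \<bar>conv_quotient a (p ^ k)\<bar> / real (p ^ k)) \<le> 1 + 128 * B / real p ^ 2"
proof -
  have B0: "B \<ge> 0" using B[of 0] by simp
  have p2: "real p \<ge> 2" using prime_ge_2_nat[OF p] by simp
  define q where "q = 16 / (9 * real p)"
  have q: "0 \<le> q" "q \<le> 8/9" using p2 by (auto simp: q_def field_simps)
  have term_le: "\<bar>conv_quotient a (p ^ k)\<bar> / real (p ^ k) \<le>
      (if k = 0 then 1 else 0) + (if k \<ge> 2 then 4 * B * q ^ k else 0)" for k
  proof (cases "k \<ge> 2")
    case True
    have "\<bar>conv_quotient a (p ^ k)\<bar> \<le> \<bar>a (p ^ k)\<bar> + 2 * \<bar>a (p ^ (k - 1))\<bar> + \<bar>a (p ^ (k - 2))\<bar>"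
      using True by (simp add: conv_quotient_prime_power[OF p])
    also have "\<dots> \<le> B * (16/9) ^ k + 2 * (B * (16/9) ^ k) + B * (16/9) ^ k"
    proof (intro add_mono mult_left_mono)
      show "\<bar>a (p ^ (k - 1))\<bar> \<le> B * (16/9) ^ k" "\<bar>a (p ^ (k - 2))\<bar> \<le> B * (16/9) ^ k"
        using B0 by (auto intro!: order.trans[OF B] mult_left_mono power_increasing)
    qed (use B in auto)
    finally have "\<bar>conv_quotient a (p ^ k)\<bar> / real (p ^ k) \<le> 4 * B * (16/9) ^ k / real (p ^ k)"
      by (intro divide_right_mono) auto
    also have "\<dots> = 4 * B * q ^ k" by (simp add: q_def power_divide power_mult_distrib)
    finally show ?thesis using True by simp
  next
    case False
    then have "k = 0 \<or> k = 1" by auto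
    then show ?thesis using ap conv_quotient_prime_power[OF p, of a k] by auto
  qed
  have sm: "summable (\<lambda>k. q ^ k)" using q by (intro summable_geometric) auto
  have "(\<Sum>k\<le>N. \<bar>conv_quotient a (p ^ k)\<bar> / real (p ^ k)) \<le>
     (\<Sum>k\<le>N. (if k = 0 then 1 else 0) + (if k \<ge> 2 then 4 * B * q ^ k else 0))"
    by (intro sum_mono term_le)
  also have "\<dots> = 1 + (\<Sum>k\<le>N. if k \<ge> 2 then 4 * B * q ^ k else 0)"
    by (simp add: sum.distrib)
  \<comment> \<open>Two further terms are added so that the shift by 2 ends in a geometric sum over
    exactly \<open>{..N}\<close>.\<close>
  also have "(\<Sum>k\<le>N. if k \<ge> 2 then 4 * B * q ^ k else 0) \<le> (\<Sum>k\<le>N+2. if k \<ge> 2 then 4 * B * q ^ k else 0)"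
    using B0 q by (intro sum_mono2) auto
  also have "\<dots> = (\<Sum>k\<in>{2..N+2}. 4 * B * q ^ k)"
    by (rule sum.mono_neutral_cong_right) auto
  also have "\<dots> = (\<Sum>k\<le>N. 4 * B * q ^ (k + 2))"
    by (rule sum.reindex_bij_witness[of _ "\<lambda>k. k + 2" "\<lambda>k. k - 2"])
      (auto simp: le_add_diff_inverse2 simp del: add_2_eq_Suc' power_Suc)
  also have "\<dots> = 4 * B * q^2 * (\<Sum>k\<le>N. q ^ k)"
    unfolding sum_distrib_left by (intro sum.cong) (auto simp: power2_eq_square)
  also have "(\<Sum>k\<le>N. q ^ k) \<le> suminf (\<lambda>k. q ^ k)"
    using q by (intro sum_le_suminf[OF sm]) auto
  also have "suminf (\<lambda>k. q ^ k) = 1 / (1 - q)" using q by (intro suminf_geometric) auto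
  also have "1 / (1 - q) \<le> 9" using q by (simp add: field_simps)
  finally have "(\<Sum>k\<le>N. \<bar>conv_quotient a (p ^ k)\<bar> / real (p ^ k)) \<le> 1 + 4 * B * q^2 * 9"
    using B0 by (simp add: mult_left_mono)
  also have "4 * B * q^2 * 9 \<le> 128 * B / real p ^ 2"
    using B0 p2 by (simp add: q_def field_simps power2_eq_square)
  finally show ?thesis by simp
qed

text \<open>By 1 + x \<le> exp x the Euler product over the primes up to \<open>N\<close> is at most
  the exponential of the sum of 128 B / p^2. This is bounded independently of \<open>N\<close>, so
  the increasing partial sums converge.\<close>

lemma summable_conv_quotient:
  fixes a :: "nat \<Rightarrow> real"
  assumes "\<And>p. prime p \<Longrightarrow> a p = 2" and B: "\<And>p k. prime p \<Longrightarrow> \<bar>a (p ^ k)\<bar> \<le> B * (16/9) ^ k"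
  shows "summable (\<lambda>n. \<bar>conv_quotient a n\<bar> / real n)"
proof -
  define h where "h n = \<bar>conv_quotient a n\<bar> / real n" for n
  have B0: "B \<ge> 0" using B[of 2 0] by simp
  have h: "multiplicative h"
    using multiplicative_conv_quotient[of a] by (auto simp: multiplicative_def h_def abs_mult)
  have sm: "summable (\<lambda>n. 1 / real n ^ 2)" using inverse_power_summable[of 2, where ?'a=real] by (simp add: field_simps)
  have bound: "(\<Sum>n\<in>{1..N}. h n) \<le> exp (128 * B * (\<Sum>n. 1 / real n ^ 2))" for N
  proof -
    define F where "F = {p. prime p \<and> p \<le> N}"
    have F: "finite F" by (simp add: F_def)
    have "(\<Sum>n\<in>{1..N}. h n) = (\<Sum>n | n \<in> {1..N} \<and> prime_factors n \<subseteq> F. h n)"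
    proof (rule sum.cong[OF _ refl], safe)
      fix n p assume "n \<in> {1..N}" "p \<in> prime_factors n"
      then show "p \<in> F" using dvd_imp_le[of p n] by (auto simp: F_def in_prime_factors_iff)
    qed
    also have "\<dots> \<le> (\<Prod>p\<in>F. \<Sum>k\<le>N. h (p ^ k))"
      by (rule sum_smooth_le_prod[OF h _ F]) (auto simp: h_def F_def)
    also have "\<dots> \<le> (\<Prod>p\<in>F. exp (128 * B * (1 / real p ^ 2)))"
    proof (rule prod_mono, safe)
      fix p assume "p \<in> F"
      then have p: "prime p" by (simp add: F_def)
      show "0 \<le> (\<Sum>k\<le>N. h (p ^ k))" by (intro sum_nonneg) (auto simp: h_def)
      have "(\<Sum>k\<le>N. h (p ^ k)) \<le> 1 + 128 * B / real p ^ 2"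
        unfolding h_def using assms p by (intro conv_quotient_euler_factor) auto
      also have "\<dots> \<le> exp (128 * B * (1 / real p ^ 2))"
        using exp_ge_add_one_self[of "128 * B / real p ^ 2"] by simp
      finally show "(\<Sum>k\<le>N. h (p ^ k)) \<le> exp (128 * B * (1 / real p ^ 2))" .
    qed
    also have "\<dots> = exp (128 * B * (\<Sum>p\<in>F. 1 / real p ^ 2))"
      using F by (simp only: exp_sum[OF F] sum_distrib_left)
    also have "\<dots> \<le> exp (128 * B * (\<Sum>n. 1 / real n ^ 2))"
      using B0 by (simp, intro mult_left_mono sum_le_suminf F) (use sm in auto)
    finally show ?thesis .
  qed
  have "summable h"
  proof (rule summableI_nonneg_bounded)
    show "0 \<le> h n" for n by (simp add: h_def)
    fix n
    \<comment> \<open>The index 0 is harmless: \<open>h 0\<close> is a division by zero, hence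
      0.\<close>
    have "(\<Sum>i<n. h i) \<le> (\<Sum>i\<in>insert 0 {1..n}. h i)"
      by (intro sum_mono2) (auto simp: h_def)
    then show "(\<Sum>i<n. h i) \<le> exp (128 * B * (\<Sum>n. 1 / real n ^ 2))"
      using bound[of n] by (simp add: h_def)
  qed
  then show ?thesis unfolding h_def[abs_def] .
qed

section \<open>The summatory function of the divisor function\<close>

lemma sum_dirichlet_conv:
  "(\<Sum>n=1..N. dirichlet_conv f g n) = (\<Sum>d=1..N. f d * (\<Sum>k=1..N div d. g k))"
proof -
  have "(\<Sum>n=1..N. dirichlet_conv f g n) =
      (\<Sum>(n, d)\<in>Sigma {1..N} (\<lambda>n. {d. d dvd n}). f d * g (n div d))"
    unfolding dirichlet_conv_def by (intro sum.Sigma) (auto intro!: finite_divisors_nat)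
  also have "\<dots> = (\<Sum>(d, k)\<in>Sigma {1..N} (\<lambda>d. {1..N div d}). f d * g k)"
  proof (rule sum.reindex_bij_witness[of _ "\<lambda>(d, k). (d * k, d)" "\<lambda>(n, d). (d, n div d)"])
    fix x assume "x \<in> Sigma {1..N} (\<lambda>n. {d. d dvd n})"
    then obtain n d where x: "x = (n, d)" "1 \<le> n" "n \<le> N" "d dvd n" by auto
    then have "d \<le> n" "d > 0" "n div d \<le> N div d" by (auto intro: dvd_imp_le div_le_mono Nat.gr0I)
    moreover from this have "n div d \<ge> 1" using x by (auto simp: Suc_le_eq div_greater_zero_iff)
    ultimately show "(case x of (n, d) \<Rightarrow> (d, n div d)) \<in> Sigma {1..N} (\<lambda>d. {1..N div d})"
      using x by auto
  next
    fix x assume "x \<in> Sigma {1..N} (\<lambda>d. {1..N div d})"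
    then obtain d k where x: "x = (d, k)" "1 \<le> d" "d \<le> N" "1 \<le> k" "k \<le> N div d" by auto
    then have "d * k \<le> N" by (metis div_times_less_eq_dividend le_trans mult.commute mult_le_mono1)
    then show "(case x of (d, k) \<Rightarrow> (d * k, d)) \<in> Sigma {1..N} (\<lambda>n. {d. d dvd n})"
      using x by auto
  qed auto
  also have "\<dots> = (\<Sum>d=1..N. f d * (\<Sum>k=1..N div d. g k))"
    by (subst sum.Sigma[symmetric]) (auto simp: sum_distrib_left)
  finally show ?thesis .
qed

definition divisor_sum :: "nat \<Rightarrow> real" where
  "divisor_sum N = (\<Sum>n=1..N. real (divisor_count n))"

lemma divisor_sum_eq: "divisor_sum N = (\<Sum>d=1..N. real (N div d))"
  by (simp add: divisor_sum_def divisor_count_eq_conv sum_dirichlet_conv del: One_nat_def)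

text \<open>The difference of \<open>harm n\<close> and \<open>ln n\<close> decreases from its value
  1 at \<open>n = 1\<close>.\<close>

lemma harm_le_ln: "n > 0 \<Longrightarrow> harm n \<le> 1 + ln (real n)"
  using decseqD[OF decseq_harm_diff_ln, of 0 "n - 1"] by (simp add: harm_def)

text \<open>Replacing \<open>N div d\<close> by the real quotient costs less than 1 for each
  \<open>d\<close>, hence at most \<open>N\<close> in all; what remains is \<open>N\<close> times a
  harmonic number between ln N and 1 + ln N. An error of order N is below the main term N ln
  N.\<close>

lemma divisor_sum_bounds:
  assumes "N > 0"
  shows "real N * (ln (real N) - 1) \<le> divisor_sum N" "divisor_sum N \<le> real N * (ln (real N) + 1)"
proof -
  have *: "real N * harm N = (\<Sum>d=1..N. real N / real d)"
    by (simp add: harm_def sum_distrib_left divide_inverse)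
  have "divisor_sum N \<le> real N * harm N"
    unfolding divisor_sum_eq * by (intro sum_mono of_nat_div_le_of_nat)
  also have "\<dots> \<le> real N * (ln (real N) + 1)"
    using harm_le_ln[OF assms] by (intro mult_left_mono) auto
  finally show "divisor_sum N \<le> real N * (ln (real N) + 1)" .
  have "ln (real N) \<le> harm N"
    using ln_le_harm[of N] assms by (smt (verit) ln_mono of_nat_0_less_iff)
  then have "real N * (ln (real N) - 1) \<le> real N * harm N - real N"
    using assms by (simp add: right_diff_distrib)
  also have "\<dots> = (\<Sum>d=1..N. real N / real d - 1)"
    by (simp add: * sum_subtractf)
  also have "\<dots> \<le> divisor_sum N"
    unfolding divisor_sum_eq
  proof (rule sum_mono)
    fix d assume "d \<in> {1..N}"
    then show "real N / real d - 1 \<le> real (N div d)"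
      using divide_nat_diff_div_nat_less_one[of N d] by linarith
  qed
  finally show "real N * (ln (real N) - 1) \<le> divisor_sum N" .
qed

lemma divisor_sum_0 [simp]: "divisor_sum 0 = 0"
  by (simp add: divisor_sum_def)

text \<open>This is the dominating bound for the later limit: 1/d times a factor free of
  \<open>d\<close>. It also holds for \<open>d > N\<close>, where the left side is 0.\<close>

lemma divisor_sum_div_le:
  assumes "d > 0" "N \<ge> 1"
  shows "divisor_sum (N div d) \<le> real N / real d * (ln (real N) + 1)"
proof (cases "N div d = 0")
  case False
  have "real (N div d) \<le> real N / real d" by (rule of_nat_div_le_of_nat)
  moreover have "ln (real (N div d)) \<le> ln (real N)"
    using False by (intro ln_mono) (auto simp del: div_eq_0_iff)
  moreover have "ln (real (N div d)) \<ge> 0" using False by (intro ln_ge_zero) (auto simp del: div_eq_0_iff)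
  ultimately have "real (N div d) * (ln (real (N div d)) + 1) \<le> real N / real d * (ln (real N) + 1)"
    by (intro mult_mono) auto
  then show ?thesis using divisor_sum_bounds(2)[of "N div d"] False by linarith
next
  case True
  have "0 \<le> real N / real d * (ln (real N) + 1)"
    using assms by (intro mult_nonneg_nonneg add_nonneg_nonneg ln_ge_zero) auto
  then show ?thesis by (simp only: True divisor_sum_0)
qed

lemma divisor_sum_div_limit:
  assumes d: "d > 0"
  shows "(\<lambda>N. divisor_sum (N div d) / (real N * ln (real N))) \<longlonglongrightarrow> 1 / real d"
proof -
  define c where "c = real d"
  have c: "c > 0" using d by (simp add: c_def)
  show ?thesis
  proof (rule tendsto_sandwich)
    have "(\<lambda>N. (real N / c - 1) * (ln (real N / c - 1) - 1) / (real N * ln (real N))) \<longlonglongrightarrow> inverse c"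
      using c by real_asymp
    then show "(\<lambda>N. (real N / c - 1) * (ln (real N / c - 1) - 1) / (real N * ln (real N))) \<longlonglongrightarrow> 1 / real d"
      by (simp add: c_def inverse_eq_divide)
    show "(\<lambda>N. real N / c * (ln (real N) + 1) / (real N * ln (real N))) \<longlonglongrightarrow> 1 / real d"
      unfolding c_def[symmetric] inverse_eq_divide[symmetric] using c by real_asymp
    show "eventually (\<lambda>N. divisor_sum (N div d) / (real N * ln (real N)) \<le>
        real N / c * (ln (real N) + 1) / (real N * ln (real N))) sequentially"
      using eventually_ge_at_top[of 2]
      unfolding c_def
      by eventually_elim (intro divide_right_mono divisor_sum_div_le mult_nonneg_nonneg, use d in auto)
    \<comment> \<open>This makes the second factor of the lower bound nonnegative, as a comparison
      factor by factor requires.\<close>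
    have "eventually (\<lambda>N. ln (real N / c - 1) \<ge> 1) sequentially"
      using c by real_asymp
    moreover have "eventually (\<lambda>N. real N / c \<ge> 2) sequentially"
      using c by real_asymp
    ultimately show "eventually (\<lambda>N. (real N / c - 1) * (ln (real N / c - 1) - 1) / (real N * ln (real N))
        \<le> divisor_sum (N div d) / (real N * ln (real N))) sequentially"
      using eventually_ge_at_top[of 2]
    proof eventually_elim
      case (elim N)
      define m where "m = N div d"
      have m: "real N / c - 1 \<le> real m" unfolding m_def c_def using divide_nat_diff_div_nat_less_one[of N d] by linarith
      then have m0: "m > 0" using elim by (cases m) auto
      have "ln (real N / c - 1) \<le> ln (real m)" using m elim by (intro ln_mono) auto
      then have "(real N / c - 1) * (ln (real N / c - 1) - 1) \<le> real m * (ln (real m) - 1)"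
        using m elim by (intro mult_mono) auto
      also have "\<dots> \<le> divisor_sum m" using divisor_sum_bounds(1)[OF m0] .
      finally show ?case using elim unfolding m_def by (intro divide_right_mono mult_nonneg_nonneg) auto
    qed
  qed
qed

text \<open>Here \<open>a\<close> is the convolution of the divisor function with some \<open>g\<close> such that
  \<open>g n / n\<close> is absolutely summable, and dominated convergence (Tannery) applies to the sum of
  \<open>g d * divisor_sum (N div d) / (N * ln N)\<close> over \<open>d\<close>.\<close>

lemma multiplicative_summatory_limit:
  fixes a :: "nat \<Rightarrow> real"
  assumes a: "multiplicative a" and ap: "\<And>p. prime p \<Longrightarrow> a p = 2"
    and B: "\<And>p k. prime p \<Longrightarrow> \<bar>a (p ^ k)\<bar> \<le> B * (16/9) ^ k"
  shows "\<exists>C. (\<lambda>N. (\<Sum>n=1..N. a n) / (real N * ln (real N))) \<longlonglongrightarrow> C"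
proof -
  define g where "g = conv_quotient a"
  define t where "t d N = g d * divisor_sum (N div d) / (real N * ln (real N))" for d N
  have "((\<lambda>N. \<Sum>d. t d N) \<longlongrightarrow> (\<Sum>d. g d / real d)) sequentially"
  proof (rule tannerys_theorem[THEN conjunct2, THEN conjunct2])
    show "((\<lambda>N. t d N) \<longlongrightarrow> g d / real d) sequentially" for d
    proof (cases "d = 0")
      case False
      have "(\<lambda>N. g d * (divisor_sum (N div d) / (real N * ln (real N)))) \<longlonglongrightarrow> g d * (1 / real d)"
        using False by (intro tendsto_intros divisor_sum_div_limit) auto
      then show ?thesis by (simp add: t_def)
    qed (simp add: t_def)
    show "summable (\<lambda>d. 2 * (\<bar>g d\<bar> / real d))"
      unfolding g_def by (intro summable_mult summable_conv_quotient[OF ap B])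
    \<comment> \<open>From N = 3 on, e \<le> N gives ln N \<ge> 1 and thus ln N + 1 \<le> 2 ln N,
      which is the origin of the factor 2.\<close>
    have "norm (t d N) \<le> 2 * (\<bar>g d\<bar> / real d)" if N: "N \<ge> 3" for d N
    proof (cases "d = 0")
      case False
      have "exp 1 \<le> real N" using N exp_le by linarith
      then have l: "ln (real N) \<ge> 1" using N by (subst ln_ge_iff) auto
      have "divisor_sum (N div d) \<le> real N / real d * (ln (real N) + 1)"
        using False N by (intro divisor_sum_div_le) auto
      also have "\<dots> \<le> real N / real d * (2 * ln (real N))" using l by (intro mult_left_mono) auto
      finally have *: "divisor_sum (N div d) / (real N * ln (real N)) \<le> 2 / real d"
        using l N False by (simp add: field_simps)
      have "divisor_sum (N div d) \<ge> 0" by (simp add: divisor_sum_def sum_nonneg)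
      then have "norm (t d N) = \<bar>g d\<bar> * (divisor_sum (N div d) / (real N * ln (real N)))"
        using l N by (simp add: t_def abs_mult)
      also have "\<dots> \<le> \<bar>g d\<bar> * (2 / real d)" by (intro mult_left_mono *) auto
      finally show ?thesis by (simp add: mult_ac)
    qed (simp add: t_def)
    then show "eventually (\<lambda>(d, N). norm (t d N) \<le> 2 * (\<bar>g d\<bar> / real d)) (at_top \<times>\<^sub>F sequentially)"
      using eventually_prodI[OF eventually_True[of "at_top :: nat filter"] eventually_ge_at_top[of "3::nat"]]
      by (auto elim!: eventually_mono)
  qed auto
  moreover have "(\<Sum>d. t d N) = (\<Sum>n=1..N. a n) / (real N * ln (real N))" for N
  proof -
    have "(\<Sum>n=1..N. a n) = (\<Sum>n=1..N. dirichlet_conv g (\<lambda>n. real (divisor_count n)) n)"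
      unfolding g_def using conv_quotient_divisor_count[OF a] by (intro sum.cong) auto
    also have "\<dots> = (\<Sum>d=1..N. g d * divisor_sum (N div d))"
      unfolding sum_dirichlet_conv divisor_sum_def ..
    finally have "(\<Sum>n=1..N. a n) / (real N * ln (real N)) = (\<Sum>d=1..N. t d N)"
      by (simp add: t_def sum_divide_distrib)
    \<comment> \<open>The terms with \<open>d = 0\<close> or \<open>d > N\<close> vanish, because
      \<open>N div d = 0\<close> there.\<close>
    also have "\<dots> = (\<Sum>d. t d N)"
      by (rule suminf_finite[symmetric]) (auto simp: t_def not_le Suc_le_eq)
    finally show ?thesis ..
  qed
  ultimately show ?thesis by auto
qed

text \<open>The hypothesis \<open>lower\<close> excludes C = 0, for which asymptotic equivalence
  would force the sums to vanish eventually. A real argument \<open>x\<close> is reached by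
  composing the limit along the integers with the floor.\<close>

theorem multiplicative_summatory_asymp_equiv:
  fixes a :: "nat \<Rightarrow> real"
  assumes "multiplicative a" "\<And>p. prime p \<Longrightarrow> a p = 2"
    and "\<And>p k. prime p \<Longrightarrow> \<bar>a (p ^ k)\<bar> \<le> B * (16/9) ^ k"
    and lower: "\<And>n. n > 0 \<Longrightarrow> real (divisor_count n) \<le> a n"
  shows "\<exists>C::real. (\<lambda>x::real. \<Sum>n\<in>{1..nat \<lfloor>x\<rfloor>}. a n) \<sim>[at_top] (\<lambda>x. C * x * ln x)"
proof -
  define S where "S N = (\<Sum>n=1..N. a n)" for N
  obtain C where C: "(\<lambda>N. S N / (real N * ln (real N))) \<longlonglongrightarrow> C"
    using multiplicative_summatory_limit[OF assms(1-3)] by (auto simp: S_def)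
  have "C \<ge> 1"
  proof (rule tendsto_le[OF _ C])
    show "(\<lambda>N. divisor_sum (N div 1) / (real N * ln (real N))) \<longlonglongrightarrow> 1"
      using divisor_sum_div_limit[of 1] by simp
    show "eventually (\<lambda>N. divisor_sum (N div 1) / (real N * ln (real N)) \<le> S N / (real N * ln (real N))) sequentially"
      using eventually_ge_at_top[of 1]
      by eventually_elim (auto simp: divisor_sum_def S_def intro!: divide_right_mono sum_mono lower)
  qed auto
  have "S \<sim>[sequentially] (\<lambda>N. C * (real N * ln (real N)))"
  proof (rule asymp_equivI')
    have "(\<lambda>N. S N / (real N * ln (real N)) / C) \<longlonglongrightarrow> C / C"
      using \<open>C \<ge> 1\<close> by (intro tendsto_intros C) auto
    then show "(\<lambda>N. S N / (C * (real N * ln (real N)))) \<longlonglongrightarrow> 1"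
      using \<open>C \<ge> 1\<close> by (simp add: mult_ac)
  qed
  then have "(S \<circ> (\<lambda>x::real. nat \<lfloor>x\<rfloor>)) \<sim>[at_top] ((\<lambda>N. C * (real N * ln (real N))) \<circ> (\<lambda>x. nat \<lfloor>x\<rfloor>))"
    by (rule asymp_equiv_compose) (rule filterlim_compose[OF filterlim_nat_sequentially filterlim_floor_sequentially])
  moreover have "(\<lambda>x::real. real (nat \<lfloor>x\<rfloor>) * ln (real (nat \<lfloor>x\<rfloor>))) \<sim>[at_top] (\<lambda>x. x * ln x)"
  proof -
    \<comment> \<open>The floor of x lies between x - 1 and x, and both bounding functions are
      equivalent to x ln x.\<close>
    have l: "(\<lambda>x::real. (x - 1) * ln (x - 1)) \<sim>[at_top] (\<lambda>x. x * ln x)" by real_asymp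
    have ge: "eventually (\<lambda>x::real. (x - 1) * ln (x - 1) \<le> real (nat \<lfloor>x\<rfloor>) * ln (real (nat \<lfloor>x\<rfloor>))) at_top"
      using eventually_ge_at_top[of "2::real"]
    proof eventually_elim
      case (elim x)
      have "x - 1 \<le> real (nat \<lfloor>x\<rfloor>)" using elim by linarith
      then show ?case using elim by (intro mult_mono ln_mono) auto
    qed
    have le: "eventually (\<lambda>x::real. real (nat \<lfloor>x\<rfloor>) * ln (real (nat \<lfloor>x\<rfloor>)) \<le> x * ln x) at_top"
      using eventually_ge_at_top[of "2::real"]
    proof eventually_elim
      case (elim x)
      have "real (nat \<lfloor>x\<rfloor>) \<le> x" "real (nat \<lfloor>x\<rfloor>) \<ge> 1" using elim by linarith+
      then show ?case using elim by (intro mult_mono ln_mono) auto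
    qed
    show ?thesis
      by (rule asymp_equiv_sandwich_real[OF l asymp_equiv_refl])
         (use ge le in \<open>eventually_elim, auto\<close>)
  qed
  then have "(\<lambda>x::real. C * (real (nat \<lfloor>x\<rfloor>) * ln (real (nat \<lfloor>x\<rfloor>)))) \<sim>[at_top] (\<lambda>x. C * (x * ln x))"
    by (rule asymp_equiv_mult[OF asymp_equiv_refl])
  ultimately have "(\<lambda>x::real. S (nat \<lfloor>x\<rfloor>)) \<sim>[at_top] (\<lambda>x. C * (x * ln x))"
    unfolding o_def by (rule asymp_equiv_trans)
  then show ?thesis unfolding S_def by (auto simp: mult.assoc)
qed

section \<open>Isomorphism classes\<close>

text \<open>The members are groups on \<open>nat\<close>, whereas \<open>G\<close> may live on any
  type. Subgroups, direct products and residue class groups on \<open>int\<close> are thereby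
  compared through a single type of classes.\<close>

definition iso_class :: "'a monoid \<Rightarrow> nat monoid set" where
  "iso_class G = {H. group H \<and> H \<cong> G}"

definition subgrp :: "'a monoid \<Rightarrow> 'a set \<Rightarrow> 'a monoid" where
  "subgrp G K = G\<lparr>carrier := K\<rparr>"

definition fin_abelian :: "nat \<Rightarrow> 'a monoid \<Rightarrow> bool" where
  "fin_abelian n G \<longleftrightarrow> comm_group G \<and> finite (carrier G) \<and> card (carrier G) = n"

definition abelian_classes :: "nat \<Rightarrow> nat monoid set set" where
  "abelian_classes n = {iso_class G | G :: nat monoid. fin_abelian n G}"

text \<open>A pair counts once however many subgroups realise it, so the cardinality is A(n); and
  sets of pairs, unlike sums over chosen representatives, can be related by bijections.\<close>

definition pair_classes :: "nat \<Rightarrow> (nat monoid set \<times> nat monoid set) set" where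
  "pair_classes n = {(iso_class G, iso_class (subgrp G K)) | (G :: nat monoid) K.
     fin_abelian n G \<and> subgroup K G}"

lemma subgrp_simps [simp]:
  "carrier (subgrp G K) = K" "monoid.mult (subgrp G K) = monoid.mult G" "one (subgrp G K) = one G"
  by (auto simp: subgrp_def)

lemma fin_abelianD:
  assumes "fin_abelian n G"
  shows "comm_group G" "group G" "finite (carrier G)" "card (carrier G) = n"
  using assms by (auto simp: fin_abelian_def comm_group_def)

lemma group_subgrp: "group G \<Longrightarrow> subgroup K G \<Longrightarrow> group (subgrp G K)"
  by (simp add: subgrp_def subgroup.subgroup_is_group)

lemma comm_group_subgrp:
  assumes "comm_group G" "subgroup K G"
  shows "comm_group (subgrp G K)"
proof -
  interpret comm_group G by fact
  show ?thesis
    by (intro group.group_comm_groupI[OF group_subgrp[OF is_group assms(2)]])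
       (use subgroup.subset[OF assms(2)] m_comm in auto)
qed

lemma fin_abelian_subgrp:
  "fin_abelian n G \<Longrightarrow> subgroup K G \<Longrightarrow> fin_abelian (card K) (subgrp G K)"
  by (auto simp: fin_abelian_def comm_group_subgrp intro: finite_subset dest: subgroup.subset)

lemma iso_subgrp:
  assumes f: "f \<in> iso G H" and K: "K \<subseteq> carrier G"
  shows "f \<in> iso (subgrp G K) (subgrp H (f ` K))"
  using f K by (auto simp: iso_def hom_def bij_betw_def inj_on_def subset_iff)

text \<open>The multiplication is stored as a set of triples, so that a fixed order leaves finitely
  many candidates. Through \<open>SOME\<close> the product depends on the table alone, even outside
  the carrier.\<close>

definition table_group :: "nat \<Rightarrow> (nat \<times> nat \<times> nat) set \<Rightarrow> nat \<Rightarrow> nat monoid" where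
  "table_group n T e = \<lparr>carrier = {..<n}, monoid.mult = (\<lambda>x y. SOME z. (x, y, z) \<in> T), one = e\<rparr>"

text \<open>The structure is transported along a numbering of the carrier. This yields a copy on
  \<open>nat\<close> of every finite group and, through the bounds on \<open>T\<close> and
  \<open>e\<close>, the finiteness of the set of classes of a given order.\<close>

lemma ex_table_group:
  fixes G :: "'a monoid"
  assumes G: "group G" "finite (carrier G)" "card (carrier G) = n"
  shows "\<exists>T e f. T \<subseteq> {..<n} \<times> {..<n} \<times> {..<n} \<and> e < n \<and> group (table_group n T e) \<and>
    f \<in> iso G (table_group n T e)"
proof -
  interpret group G by fact
  obtain f where f: "bij_betw f (carrier G) {..<n}"
    using G finite_same_card_bij[of "carrier G" "{..<n}"] by auto
  define T where "T = (\<lambda>(x, y). (f x, f y, f (x \<otimes>\<^bsub>G\<^esub> y))) ` (carrier G \<times> carrier G)"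
  define H where "H = table_group n T (f \<one>\<^bsub>G\<^esub>)"
  have inj: "inj_on f (carrier G)" and im: "f ` carrier G = {..<n}"
    using f by (auto simp: bij_betw_def)
  have mult: "f x \<otimes>\<^bsub>H\<^esub> f y = f (x \<otimes>\<^bsub>G\<^esub> y)" if "x \<in> carrier G" "y \<in> carrier G" for x y
  proof -
    have "(f x, f y, z) \<in> T \<longleftrightarrow> z = f (x \<otimes>\<^bsub>G\<^esub> y)" for z
      using that inj by (auto simp: T_def inj_on_def)
    then show ?thesis by (simp add: H_def table_group_def)
  qed
  have iso: "f \<in> iso G H"
    using mult f im by (auto simp: iso_def hom_def H_def table_group_def)
  have "group (H\<lparr>one := f \<one>\<^bsub>G\<^esub>\<rparr>)"
    using hom_imp_img_group[of f H] iso im by (simp add: iso_def H_def table_group_def)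
  then have "group H" by (simp add: H_def table_group_def)
  moreover have "T \<subseteq> {..<n} \<times> {..<n} \<times> {..<n}" using im by (force simp: T_def)
  moreover have "f \<one>\<^bsub>G\<^esub> < n" using im by auto
  ultimately show ?thesis using iso unfolding H_def by blast
qed

lemma iso_class_cong:
  assumes "group G" "group H" "G \<cong> H"
  shows "iso_class G = iso_class H"
  using assms by (auto simp: iso_class_def intro: iso_trans group.iso_sym)

lemma iso_class_nonempty:
  assumes "group G" "finite (carrier G)"
  shows "\<exists>H. H \<in> iso_class G"
proof -
  obtain T e f where "group (table_group (card (carrier G)) T e)" "f \<in> iso G (table_group (card (carrier G)) T e)"
    using ex_table_group[OF assms refl] by blast
  then show ?thesis unfolding iso_class_def using group.iso_sym[OF assms(1) is_isoI] by blast
qed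

lemma some_iso_class:
  assumes "group G" "finite (carrier G)"
  shows "group (SOME H. H \<in> iso_class G)" "(SOME H. H \<in> iso_class G) \<cong> G"
  using someI_ex[OF iso_class_nonempty[OF assms]] by (auto simp: iso_class_def)

text \<open>Equality of classes gives an isomorphism through a common member. Hence the finiteness
  of \<open>G\<close>: an infinite group may have no copy on \<open>nat\<close>, and its class would
  be empty.\<close>

lemma iso_class_eq_iff:
  assumes "group G" "finite (carrier G)" "group H"
  shows "iso_class G = iso_class H \<longleftrightarrow> G \<cong> H"
proof
  assume "iso_class G = iso_class H"
  then obtain F where "F \<in> iso_class G" "F \<in> iso_class H" using iso_class_nonempty[OF assms(1,2)] by auto
  then show "G \<cong> H" by (auto simp: iso_class_def intro: iso_trans group.iso_sym)
qed (use assms iso_class_cong in blast)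

lemma fin_abelian_cong:
  assumes "fin_abelian n G" "group H" "G \<cong> H"
  shows "fin_abelian n H"
proof -
  interpret comm_group G using assms by (simp add: fin_abelian_def)
  have "comm_group H" using assms by (intro iso_imp_comm_group) (auto simp: group_def)
  then show ?thesis using assms iso_same_card[of G H] iso_finite[of G H] by (simp add: fin_abelian_def)
qed

text \<open>The definition asks for a witness on \<open>nat\<close>; a table group supplies it, with
  \<open>K\<close> carried along by the isomorphism.\<close>

lemma pair_classes_memI:
  fixes G :: "'a monoid"
  assumes G: "fin_abelian n G" and K: "subgroup K G"
  shows "(iso_class G, iso_class (subgrp G K)) \<in> pair_classes n"
proof -
  note g = fin_abelianD[OF G]
  obtain T e f where H: "group (table_group n T e)" and f: "f \<in> iso G (table_group n T e)"
    using ex_table_group[OF g(2,3,4)] by blast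
  define H where "H = table_group n T e"
  have H: "group H" "f \<in> iso G H" using H f by (auto simp: H_def)
  have K': "subgroup (f ` K) H" using subgroup.iso_subgroup[OF K g(2) H(1,2)] .
  have "iso_class G = iso_class H" using H g by (intro iso_class_cong) (auto intro: is_isoI)
  moreover have "iso_class (subgrp G K) = iso_class (subgrp H (f ` K))"
    using iso_subgrp[OF H(2) subgroup.subset[OF K]] K K' H g
    by (intro iso_class_cong group_subgrp) (auto intro: is_isoI)
  moreover have "fin_abelian n H" using fin_abelian_cong[OF G H(1)] H(2) by (auto intro: is_isoI)
  ultimately show ?thesis using K' by (auto simp: pair_classes_def)
qed

lemma abelian_classes_memI: "fin_abelian n G \<Longrightarrow> iso_class G \<in> abelian_classes n"
  using pair_classes_memI[of n G "carrier G"] group.subgroup_self[of G]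
  by (auto simp: pair_classes_def abelian_classes_def fin_abelian_def comm_group_def)

lemma finite_abelian_classes: "finite (abelian_classes n)"
proof (rule finite_subset)
  show "abelian_classes n \<subseteq> (\<lambda>(T, e). iso_class (table_group n T e)) `
     (Pow ({..<n} \<times> {..<n} \<times> {..<n}) \<times> {..<n})"
  proof
    fix c assume "c \<in> abelian_classes n"
    then obtain G :: "nat monoid" where c: "c = iso_class G" "fin_abelian n G" by (auto simp: abelian_classes_def)
    obtain T e f where T: "T \<subseteq> {..<n} \<times> {..<n} \<times> {..<n}" "e < n" "group (table_group n T e)"
      "f \<in> iso G (table_group n T e)"
      using ex_table_group[of G n] fin_abelianD[OF c(2)] by blast
    then have "c = iso_class (table_group n T e)"
      unfolding c(1) using fin_abelianD(2)[OF c(2)] by (intro iso_class_cong is_isoI)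
    then show "c \<in> (\<lambda>(T, e). iso_class (table_group n T e)) ` (Pow ({..<n} \<times> {..<n} \<times> {..<n}) \<times> {..<n})"
      using T by force
  qed
qed auto

section \<open>A(n) as a number of pairs of classes\<close>

lemma iso_classes_abelian: "iso_classes (abelian_groups_of_order n) = abelian_classes n"
proof -
  define S where "S = abelian_groups_of_order n"
  have S: "G \<in> S \<longleftrightarrow> fin_abelian n G" for G
    by (auto simp: S_def abelian_groups_of_order_def fin_abelian_def Coset.order_def)
  \<comment> \<open>As \<open>S\<close> is closed under isomorphism, restricting the relation to
    \<open>S\<close> cuts nothing off the full class.\<close>
  have eq: "{(G, H). G \<in> S \<and> H \<in> S \<and> G \<cong> H} `` {G} = iso_class G" if "G \<in> S" for G
  proof -
    have "group G" "fin_abelian n G" using that fin_abelianD(2) by (auto simp: S)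
    then have "H \<in> S \<and> G \<cong> H \<longleftrightarrow> group H \<and> H \<cong> G" for H
      unfolding S using group.iso_sym[of G H] group.iso_sym[of H G] fin_abelian_cong[of n G H] fin_abelianD(2)[of n H]
      by blast
    then show ?thesis using that unfolding iso_class_def by blast
  qed
  have "iso_classes S = iso_class ` S"
    unfolding iso_classes_def quotient_def UNION_singleton_eq_range using eq by (rule image_cong[OF refl])
  also have "\<dots> = abelian_classes n" unfolding abelian_classes_def using S by blast
  finally show ?thesis by (simp add: S_def)
qed

lemma subgroup_classes_eq:
  assumes "group G"
  shows "subgroup_classes G = {iso_class (subgrp G K) | K. subgroup K G}"
proof -
  define S where "S = {H :: nat monoid. group H \<and> (\<exists>K. subgroup K G \<and> H \<cong> subgrp G K)}"
  have eq: "{(G, H). G \<in> S \<and> H \<in> S \<and> G \<cong> H} `` {H} = iso_class H" if H: "H \<in> S" for H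
  proof -
    obtain K where K: "group H" "subgroup K G" "H \<cong> subgrp G K" using H unfolding S_def by blast
    have "F \<in> S \<and> H \<cong> F \<longleftrightarrow> group F \<and> F \<cong> H" for F
      using K group.iso_sym[of F H] group.iso_sym[of H F] iso_trans[of F H "subgrp G K"] unfolding S_def by blast
    then show ?thesis using H unfolding iso_class_def by blast
  qed
  have sub: "subgrp G K \<in> S" if "subgroup K G" for K
    using that group_subgrp[OF assms that] iso_refl[of "subgrp G K"] unfolding S_def by blast
  have rep: "\<exists>K. subgroup K G \<and> iso_class H = iso_class (subgrp G K)" if "H \<in> S" for H
    using that iso_class_cong group_subgrp[OF assms] unfolding S_def by blast
  have "iso_classes S = iso_class ` S"
    unfolding iso_classes_def quotient_def UNION_singleton_eq_range using eq by (rule image_cong[OF refl])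
  also have "\<dots> = {iso_class (subgrp G K) | K. subgroup K G}"
    using sub rep by (intro subset_antisym) (simp_all add: subset_iff image_iff, metis+)
  finally show ?thesis unfolding subgroup_classes_def S_def subgrp_def .
qed

text \<open>The fibre over a class is the same for every representative, so the sum of fibre sizes
  in \<open>subgroup_class_total\<close> counts these pairs.\<close>

lemma pair_classes_eq_Sigma:
  "pair_classes n = Sigma (abelian_classes n) (\<lambda>c. subgroup_classes (SOME G. G \<in> c))"
proof -
  have *: "subgroup_classes (SOME H. H \<in> iso_class G) = {iso_class (subgrp G K) | K. subgroup K G}"
    if "fin_abelian n G" for G :: "nat monoid"
  proof -
    note g = fin_abelianD(2,3)[OF that]
    show ?thesis
      using subgroup_classes_cong[OF some_iso_class(1)[OF g] g(1) some_iso_class(2)[OF g]]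
        subgroup_classes_eq[OF g(1)] by (rule trans)
  qed
  show ?thesis
  proof (intro subset_antisym subsetI)
    fix x assume "x \<in> pair_classes n"
    then obtain G :: "nat monoid" and K
      where x: "x = (iso_class G, iso_class (subgrp G K))" "fin_abelian n G" "subgroup K G"
      unfolding pair_classes_def by blast
    then show "x \<in> Sigma (abelian_classes n) (\<lambda>c. subgroup_classes (SOME G. G \<in> c))"
      unfolding x(1) using abelian_classes_memI[OF x(2)] by (intro SigmaI) (simp_all only: *[OF x(2)], blast)
  next
    fix x assume "x \<in> Sigma (abelian_classes n) (\<lambda>c. subgroup_classes (SOME G. G \<in> c))"
    then obtain G :: "nat monoid" and d
      where x: "x = (iso_class G, d)" "fin_abelian n G" "d \<in> subgroup_classes (SOME H. H \<in> iso_class G)"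
      unfolding abelian_classes_def by blast
    then show "x \<in> pair_classes n"
      unfolding *[OF x(2)] pair_classes_def by blast
  qed
qed

lemma finite_pair_classes: "finite (pair_classes n)"
  and subgroup_class_total_eq_card: "subgroup_class_total n = card (pair_classes n)"
proof -
  have fin: "finite (subgroup_classes (SOME G. G \<in> c))" if c: "c \<in> abelian_classes n" for c
  proof -
    obtain G :: "nat monoid" where G: "c = iso_class G" "fin_abelian n G" using c by (auto simp: abelian_classes_def)
    define H where "H = (SOME H. H \<in> iso_class G)"
    have H: "group H" "H \<cong> G" using some_iso_class[of G] fin_abelianD[OF G(2)] by (auto simp: H_def)
    have "finite (carrier H)" using iso_finite[OF H(2)] fin_abelianD[OF G(2)] by simp
    then have "finite {K. subgroup K H}"
      by (rule finite_subset[rotated, OF finite_Pow_iff[THEN iffD2]]) (auto dest: subgroup.subset)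
    then have "finite (subgroup_classes H)"
      by (simp add: subgroup_classes_eq[OF H(1)])
    then show ?thesis by (simp add: G H_def)
  qed
  show "finite (pair_classes n)"
    unfolding pair_classes_eq_Sigma using fin finite_abelian_classes by (intro finite_SigmaI)
  show "subgroup_class_total n = card (pair_classes n)"
    unfolding pair_classes_eq_Sigma subgroup_class_total_def iso_classes_abelian
    using fin finite_abelian_classes by (simp add: card_SigmaI)
qed

section \<open>Coprime products\<close>

text \<open>On classes of finite groups the choice of representatives is immaterial, because direct
  products respect isomorphism; see \<open>class_prod_iso_class\<close>.\<close>

definition class_prod :: "nat monoid set \<Rightarrow> nat monoid set \<Rightarrow> nat monoid set" where
  "class_prod C D = iso_class ((SOME G. G \<in> C) \<times>\<times> (SOME H. H \<in> D))"

definition torsion :: "nat \<Rightarrow> 'a monoid \<Rightarrow> 'a set" where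
  "torsion n G = {x \<in> carrier G. x [^]\<^bsub>G\<^esub> n = \<one>\<^bsub>G\<^esub>}"

definition class_torsion :: "nat \<Rightarrow> nat monoid set \<Rightarrow> nat monoid set" where
  "class_torsion n C = iso_class (subgrp (SOME G. G \<in> C) (torsion n (SOME G. G \<in> C)))"

lemma DirProd_is_iso_cong:
  assumes "group G" "G \<cong> G'" "H \<cong> H'"
  shows "G \<times>\<times> H \<cong> G' \<times>\<times> H'"
  using assms group.DirProd_iso_set_trans[OF assms(1)] unfolding is_iso_def by blast

lemma class_prod_iso_class:
  assumes "group G" "finite (carrier G)" "group H" "finite (carrier H)"
  shows "class_prod (iso_class G) (iso_class H) = iso_class (G \<times>\<times> H)"
  unfolding class_prod_def
  by (intro iso_class_cong DirProd_group DirProd_is_iso_cong some_iso_class assms)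

lemma comm_group_DirProd:
  assumes "comm_group G" "comm_group H"
  shows "comm_group (G \<times>\<times> H)"
proof -
  interpret G: comm_group G by fact
  interpret H: comm_group H by fact
  show ?thesis
    by (intro group.group_comm_groupI[OF DirProd_group])
       (auto simp: G.m_comm H.m_comm G.is_group H.is_group)
qed

lemma fin_abelian_DirProd:
  "fin_abelian m G \<Longrightarrow> fin_abelian n H \<Longrightarrow> fin_abelian (m * n) (G \<times>\<times> H)"
  by (auto simp: fin_abelian_def comm_group_DirProd card_cartesian_product)

lemma nat_pow_subgrp [simp]: "x [^]\<^bsub>subgrp G K\<^esub> (n::nat) = x [^]\<^bsub>G\<^esub> n"
  by (simp add: nat_pow_def)

lemma nat_pow_DirProd:
  "(x, y) [^]\<^bsub>G \<times>\<times> H\<^esub> (n::nat) = (x [^]\<^bsub>G\<^esub> n, y [^]\<^bsub>H\<^esub> n)"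
  by (induction n) (auto simp: nat_pow_def)

lemma subgroup_torsion:
  assumes "comm_group G"
  shows "subgroup (torsion n G) G"
proof -
  interpret comm_group G by fact
  show ?thesis
    by (rule subgroupI) (auto simp: torsion_def nat_pow_inv pow_mult_distrib m_comm intro!: exI[of _ "\<one>\<^bsub>G\<^esub>"])
qed

lemma iso_image_torsion:
  assumes "group G" "group H" "f \<in> iso G H"
  shows "f ` torsion n G = torsion n H"
proof -
  interpret group_hom G H f
    using assms by (simp add: group_hom_def group_hom_axioms_def iso_def)
  have f: "inj_on f (carrier G)" "f ` carrier G = carrier H"
    using assms by (auto simp: iso_def bij_betw_def)
  have "f x [^]\<^bsub>H\<^esub> n = \<one>\<^bsub>H\<^esub> \<longleftrightarrow> x [^]\<^bsub>G\<^esub> n = \<one>\<^bsub>G\<^esub>" if "x \<in> carrier G" for x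
    using f(1) that by (metis hom_nat_pow hom_one inj_onD G.nat_pow_closed G.one_closed)
  then have "f ` torsion n G = {y \<in> f ` carrier G. y [^]\<^bsub>H\<^esub> n = \<one>\<^bsub>H\<^esub>}" by (auto simp: torsion_def)
  then show ?thesis by (simp add: f(2) torsion_def)
qed

lemma torsion_is_iso:
  assumes "group G" "group H" "G \<cong> H"
  shows "subgrp G (torsion n G) \<cong> subgrp H (torsion n H)"
proof -
  obtain f where f: "f \<in> iso G H" using assms by (auto simp: is_iso_def)
  show ?thesis
    using iso_subgrp[OF f, of "torsion n G"] iso_image_torsion[OF assms(1,2) f, of n]
    by (auto simp: torsion_def intro: is_isoI)
qed

lemma class_torsion_iso_class:
  assumes "fin_abelian k G"
  shows "class_torsion n (iso_class G) = iso_class (subgrp G (torsion n G))"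
proof -
  note g = fin_abelianD[OF assms]
  note s = some_iso_class[OF g(2,3)]
  have "comm_group (SOME H. H \<in> iso_class G)"
    using fin_abelian_cong[OF assms s(1) group.iso_sym[OF s]] by (simp add: fin_abelian_def)
  then show ?thesis
    unfolding class_torsion_def
    by (intro iso_class_cong group_subgrp torsion_is_iso subgroup_torsion s g)
qed

text \<open>This serves two decompositions: into coprime torsion parts, and into a cyclic subgroup
  and its complement.\<close>

lemma internal_DirProd:
  assumes G: "comm_group G" and A: "subgroup A G" and B: "subgroup B G"
    and AB: "A \<inter> B \<subseteq> {\<one>\<^bsub>G\<^esub>}"
    and gen: "\<And>x. x \<in> carrier G \<Longrightarrow> \<exists>a\<in>A. \<exists>b\<in>B. x = a \<otimes>\<^bsub>G\<^esub> b"
  shows "subgrp G A \<times>\<times> subgrp G B \<cong> G"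
proof -
  interpret comm_group G by fact
  let ?f = "\<lambda>(a, b). a \<otimes>\<^bsub>G\<^esub> b"
  have c: "a \<in> carrier G" if "a \<in> A \<or> a \<in> B" for a
    using that subgroup.subset[OF A] subgroup.subset[OF B] by auto
  have "?f \<in> hom (subgrp G A \<times>\<times> subgrp G B) G"
    by (auto simp: hom_def c m_ac)
  then interpret f: group_hom "subgrp G A \<times>\<times> subgrp G B" G ?f
    by (intro group_hom.intro DirProd_group group_subgrp A B is_group) (simp add: group_hom_axioms_def)
  have "?f \<in> iso (subgrp G A \<times>\<times> subgrp G B) G"
    unfolding f.iso_iff
  proof safe
    fix x assume "x \<in> carrier G"
    then show "x \<in> ?f ` carrier (subgrp G A \<times>\<times> subgrp G B)" using gen by force
  next
    fix a b assume ab: "(a, b) \<in> carrier (subgrp G A \<times>\<times> subgrp G B)" and eq: "a \<otimes>\<^bsub>G\<^esub> b = \<one>\<^bsub>G\<^esub>"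
    then have "a = inv\<^bsub>G\<^esub> b" using c by (simp add: inv_equality)
    then have "a \<in> A \<inter> B" using ab subgroup.m_inv_closed[OF B] by auto
    then have "a = \<one>\<^bsub>G\<^esub>" using AB by auto
    then show "(a, b) = \<one>\<^bsub>subgrp G A \<times>\<times> subgrp G B\<^esub>" using eq ab c by auto
  qed
  then show ?thesis by (rule is_isoI)
qed

section \<open>Splitting an abelian group by coprime torsion\<close>

lemma coprime_pow_eq_one:
  assumes "group G" "x \<in> carrier G" "x [^]\<^bsub>G\<^esub> (m::nat) = \<one>\<^bsub>G\<^esub>" "x [^]\<^bsub>G\<^esub> (n::nat) = \<one>\<^bsub>G\<^esub>" "coprime m n"
  shows "x = \<one>\<^bsub>G\<^esub>"
proof -
  interpret group G by fact
  have "ord x dvd m" "ord x dvd n" using assms by (simp_all add: pow_eq_id)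
  then have "ord x = 1" using assms(5) by (metis coprime_common_divisor nat_dvd_1_iff_1)
  then show ?thesis using assms(2) ord_eq_1 by blast
qed

text \<open>The Chinese remainder theorem gives \<open>a\<close> congruent to 1 mod m and 0 mod n,
  and \<open>b\<close> the other way round; then x = x^a x^b, with x^a killed by \<open>m\<close>
  and x^b by \<open>n\<close>. The hypothesis concerns the exponent and not the order, so that it
  passes to subgroups of a group of order \<open>m * n\<close>.\<close>

lemma torsion_decomposition:
  assumes G: "comm_group G" and ex: "\<And>x. x \<in> carrier G \<Longrightarrow> x [^]\<^bsub>G\<^esub> (m * n) = \<one>\<^bsub>G\<^esub>"
    and mn: "coprime m n"
  shows "subgrp G (torsion m G) \<times>\<times> subgrp G (torsion n G) \<cong> G"
proof (rule internal_DirProd[OF G subgroup_torsion[OF G] subgroup_torsion[OF G]])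
  interpret comm_group G by fact
  show "torsion m G \<inter> torsion n G \<subseteq> {\<one>\<^bsub>G\<^esub>}"
    using coprime_pow_eq_one[OF is_group] mn by (auto simp: torsion_def)
  fix x assume x: "x \<in> carrier G"
  obtain a where a: "[a = 1] (mod m)" "[a = 0] (mod n)"
    using binary_chinese_remainder_nat[OF mn] by blast
  obtain b where b: "[b = 0] (mod m)" "[b = 1] (mod n)"
    using binary_chinese_remainder_nat[OF mn] by blast
  have "[a + b = 1 + 0] (mod m)" "[a + b = 0 + 1] (mod n)" using cong_add[OF a(1) b(1)] cong_add[OF a(2) b(2)] by auto
  then have "[a + b = 1] (mod (m * n))" using mn by (intro coprime_cong_mult_nat) auto
  moreover have o: "ord x dvd m * n" using ex[OF x] x by (simp add: pow_eq_id)
  ultimately have "[a + b = 1] (mod ord x)" by (rule cong_dvd_modulus_nat)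
  then have "[int 1 = int (a + b)] (mod int (ord x))" by (simp only: cong_int_iff cong_sym_eq)
  then have "int (ord x) dvd int 1 - int (a + b)" by (simp only: cong_iff_dvd_diff)
  then have "x [^]\<^bsub>G\<^esub> (a + b) = x [^]\<^bsub>G\<^esub> (1::nat)"
    using int_pow_eq[OF x, of "int (a + b)" "int 1"] by (simp only: int_pow_int)
  then have "x = x [^]\<^bsub>G\<^esub> a \<otimes>\<^bsub>G\<^esub> x [^]\<^bsub>G\<^esub> b" using x by (simp add: nat_pow_mult)
  moreover have "x [^]\<^bsub>G\<^esub> a \<in> torsion m G"
    using x a(2) o by (auto simp: torsion_def nat_pow_pow pow_eq_id cong_0_iff mult.commute intro: dvd_trans mult_dvd_mono)
  moreover have "x [^]\<^bsub>G\<^esub> b \<in> torsion n G"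
    using x b(1) o by (auto simp: torsion_def nat_pow_pow pow_eq_id cong_0_iff intro: dvd_trans mult_dvd_mono)
  ultimately show "\<exists>a\<in>torsion m G. \<exists>b\<in>torsion n G. x = a \<otimes>\<^bsub>G\<^esub> b" by blast
qed

text \<open>An element of \<open>H\<close> killed by both \<open>m\<close> and \<open>n\<close> is
  trivial, so the m-torsion of the product is \<open>G\<close> times the trivial subgroup.\<close>

lemma torsion_DirProd:
  assumes G: "group G" and H: "group H" and exG: "\<And>x. x \<in> carrier G \<Longrightarrow> x [^]\<^bsub>G\<^esub> m = \<one>\<^bsub>G\<^esub>"
    and exH: "\<And>x. x \<in> carrier H \<Longrightarrow> x [^]\<^bsub>H\<^esub> n = \<one>\<^bsub>H\<^esub>" and mn: "coprime m n"
  shows "G \<cong> subgrp (G \<times>\<times> H) (torsion m (G \<times>\<times> H))"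
proof -
  interpret G: group G by fact
  interpret H: group H by fact
  have eq: "torsion m (G \<times>\<times> H) = carrier G \<times> {\<one>\<^bsub>H\<^esub>}"
    using exG coprime_pow_eq_one[OF H _ _ exH mn] by (auto simp: torsion_def nat_pow_DirProd)
  have "(\<lambda>x. (x, \<one>\<^bsub>H\<^esub>)) \<in> iso G (subgrp (G \<times>\<times> H) (carrier G \<times> {\<one>\<^bsub>H\<^esub>}))"
    by (auto simp: iso_def hom_def bij_betw_def inj_on_def)
  then show ?thesis unfolding eq by (rule is_isoI)
qed

lemma torsion_DirProd':
  assumes G: "group G" and H: "group H" and "\<And>x. x \<in> carrier G \<Longrightarrow> x [^]\<^bsub>G\<^esub> m = \<one>\<^bsub>G\<^esub>"
    and "\<And>x. x \<in> carrier H \<Longrightarrow> x [^]\<^bsub>H\<^esub> n = \<one>\<^bsub>H\<^esub>" and "coprime m n"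
  shows "H \<cong> subgrp (G \<times>\<times> H) (torsion n (G \<times>\<times> H))"
proof -
  have "H \<cong> subgrp (H \<times>\<times> G) (torsion n (H \<times>\<times> G))"
    using assms by (intro torsion_DirProd) (auto simp: coprime_commute)
  moreover have "subgrp (H \<times>\<times> G) (torsion n (H \<times>\<times> G)) \<cong> subgrp (G \<times>\<times> H) (torsion n (G \<times>\<times> H))"
    using DirProd_commute_iso_set G H by (intro torsion_is_iso DirProd_group is_isoI)
  ultimately show ?thesis by (rule iso_trans)
qed

text \<open>A common prime factor p would give a nontrivial element of the m-torsion killed by p,
  and p is coprime to \<open>m\<close>.\<close>

lemma card_torsion_coprime:
  assumes G: "fin_abelian (m * n) G" and mn: "coprime m n"
  shows "coprime (card (torsion m G)) n"
proof (rule ccontr)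
  assume "\<not> coprime (card (torsion m G)) n"
  then obtain p where p: "prime p" "p dvd card (torsion m G)" "p dvd n"
    by (metis coprime_iff_gcd_eq_1 gcd_nat.boundedE prime_factor_nat)
  interpret comm_group G using G by (simp add: fin_abelian_def)
  define T where "T = subgrp G (torsion m G)"
  have T: "group T" "finite (carrier T)" "card (carrier T) = card (torsion m G)"
    using fin_abelianD(2-4)[OF fin_abelian_subgrp[OF G subgroup_torsion[OF comm_group_axioms]]]
    by (auto simp: T_def)
  obtain k where "card (torsion m G) = p * k" using p by (auto elim: dvdE)
  \<comment> \<open>Sylow's theorem with exponent 1, that is, Cauchy's theorem.\<close>
  then obtain H where H: "subgroup H T" "card H = p ^ 1"
    using sylow_thm[OF p(1) T(1), of 1 k] T by (auto simp: Coset.order_def)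
  interpret T: group T by fact
  have "\<not> H \<subseteq> {\<one>\<^bsub>T\<^esub>}"
    using H(2) prime_gt_1_nat[OF p(1)] card_mono[of "{\<one>\<^bsub>T\<^esub>}" H] by auto
  then obtain x where x: "x \<in> H" "x \<noteq> \<one>\<^bsub>T\<^esub>" by auto
  interpret H: group "subgrp T H" using T.is_group H(1) by (rule group_subgrp)
  have "x [^]\<^bsub>subgrp T H\<^esub> Coset.order (subgrp T H) = \<one>\<^bsub>subgrp T H\<^esub>"
    using x by (intro H.pow_order_eq_1) auto
  then have "x [^]\<^bsub>G\<^esub> p = \<one>\<^bsub>G\<^esub>" using H(2) by (simp add: Coset.order_def T_def)
  moreover have xm: "x \<in> torsion m G" using x subgroup.subset[OF H(1)] by (auto simp: T_def)
  moreover have "coprime p m" using p mn by (meson coprime_divisors coprime_commute dvd_refl)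
  ultimately have "x = \<one>\<^bsub>G\<^esub>" using coprime_pow_eq_one[OF is_group, of x p m] by (auto simp: torsion_def)
  then show False using x by (simp add: T_def)
qed

lemma exponent_fin_abelian: 
  assumes "fin_abelian n G" "x \<in> carrier G" "n dvd k"
  shows "x [^]\<^bsub>G\<^esub> k = \<one>\<^bsub>G\<^esub>"
proof -
  interpret group G using fin_abelianD[OF assms(1)] by simp
  have "ord x dvd n" using ord_dvd_group_order[OF assms(2)] fin_abelianD(4)[OF assms(1)]
    by (simp add: Coset.order_def)
  then show ?thesis using assms by (auto simp: pow_eq_id intro: dvd_trans)
qed

text \<open>The two orders multiply to \<open>m * n\<close> and each is coprime to the other factor,
  so each divides its own; if one were smaller, the product would be too small.\<close>

lemma card_torsion:
  assumes G: "fin_abelian (m * n) G" and mn: "coprime m n"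
  shows "card (torsion m G) = m" "card (torsion n G) = n"
proof -
  note g = fin_abelianD[OF G]
  interpret comm_group G by (rule g)
  have m0: "m * n > 0" using g one_closed by (metis card_gt_0_iff empty_iff)
  have G': "fin_abelian (n * m) G" using G by (simp add: mult.commute)
  have "subgrp G (torsion m G) \<times>\<times> subgrp G (torsion n G) \<cong> G"
    using g exponent_fin_abelian[OF G] mn by (intro torsion_decomposition) auto
  then have eq: "card (torsion m G) * card (torsion n G) = m * n"
    using iso_same_card g by (fastforce simp: card_cartesian_product)
  have "coprime (card (torsion m G)) n" "coprime (card (torsion n G)) m"
    using card_torsion_coprime[OF G mn] card_torsion_coprime[OF G'] mn by (auto simp: coprime_commute)
  then have "card (torsion m G) dvd m" "card (torsion n G) dvd n"
    using eq by (metis coprime_dvd_mult_left_iff dvd_triv_left, metis coprime_dvd_mult_right_iff dvd_triv_right)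
  then have le: "card (torsion m G) \<le> m" "card (torsion n G) \<le> n" using m0 by (auto intro!: dvd_imp_le)
  show "card (torsion m G) = m"
  proof (rule ccontr)
    assume "card (torsion m G) \<noteq> m"
    then have "card (torsion m G) * card (torsion n G) < m * n"
      using le m0 by (intro le_less_trans[OF mult_le_mono2 mult_less_mono1]) auto
    then show False using eq by simp
  qed
  then show "card (torsion n G) = n" using eq m0 by simp
qed

lemma finite_group_of_class:
  assumes "fin_abelian n (G :: 'a monoid)" "subgroup K G"
  shows "group (subgrp G K)" "finite (carrier (subgrp G K))" "K \<subseteq> carrier G"
  using assms fin_abelianD[OF assms(1)] fin_abelianD[OF fin_abelian_subgrp[OF assms]] subgroup.subset
  by auto

lemma subgrp_DirProd: "subgrp (G \<times>\<times> H) (K \<times> L) = subgrp G K \<times>\<times> subgrp H L"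
  by (simp add: subgrp_def DirProd_def)

lemma subgrp_subgrp: "subgrp (subgrp G K) L = subgrp G L"
  by (simp add: subgrp_def)

lemma torsion_subgrp: "K \<subseteq> carrier G \<Longrightarrow> torsion n (subgrp G K) = K \<inter> torsion n G"
  by (auto simp: torsion_def)

text \<open>Passing to torsion inverts the product in both components at once: the torsion of a
  subgroup \<open>K\<close> is \<open>K\<close> intersected with the torsion of \<open>G\<close>,
  and \<open>K\<close> is in turn the product of these intersections.\<close>

lemma pair_classes_coprime_bij:
  assumes mn: "coprime m n"
  shows "bij_betw (\<lambda>((C, C'), (D, D')). (class_prod C D, class_prod C' D'))
     (pair_classes m \<times> pair_classes n) (pair_classes (m * n))"
proof (rule bij_betw_byWitness[of _ "\<lambda>(C, C'). ((class_torsion m C, class_torsion m C'), (class_torsion n C, class_torsion n C'))"])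
  let ?\<phi> = "\<lambda>((C, C'), (D, D')). (class_prod C D, class_prod C' D')"
  let ?\<psi> = "\<lambda>(C, C'). ((class_torsion m C, class_torsion m C'), (class_torsion n C, class_torsion n C'))"
  \<comment> \<open>The orders \<open>m'\<close> and \<open>n'\<close> merely divide
    \<open>m\<close> and \<open>n\<close>, so that one statement covers both the ambient groups and
    their subgroups.\<close>
  have tors: "class_torsion m (class_prod (iso_class G) (iso_class H)) = iso_class G \<and>
     class_torsion n (class_prod (iso_class G) (iso_class H)) = iso_class H"
    if G: "fin_abelian m' G" "m' dvd m" and H: "fin_abelian n' H" "n' dvd n" for m' n' and G :: "nat monoid" and H :: "nat monoid"
  proof -
    note g = fin_abelianD[OF G(1)] and h = fin_abelianD[OF H(1)]
    have ab: "fin_abelian (m' * n') (G \<times>\<times> H)" by (rule fin_abelian_DirProd[OF G(1) H(1)])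
    note gh = fin_abelianD[OF ab]
    have t: "group (subgrp (G \<times>\<times> H) (torsion k (G \<times>\<times> H)))" for k
      by (intro group_subgrp subgroup_torsion gh)
    have exg: "x [^]\<^bsub>G\<^esub> m = \<one>\<^bsub>G\<^esub>" if "x \<in> carrier G" for x using exponent_fin_abelian[OF G(1) that G(2)] .
    have exh: "x [^]\<^bsub>H\<^esub> n = \<one>\<^bsub>H\<^esub>" if "x \<in> carrier H" for x using exponent_fin_abelian[OF H(1) that H(2)] .
    show ?thesis
      unfolding class_prod_iso_class[OF g(2,3) h(2,3)] class_torsion_iso_class[OF ab]
      using iso_class_cong[OF g(2) t torsion_DirProd[OF g(2) h(2) exg exh mn]]
        iso_class_cong[OF h(2) t torsion_DirProd'[OF g(2) h(2) exg exh mn]] by simp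
  qed
  show "\<forall>x\<in>pair_classes m \<times> pair_classes n. ?\<psi> (?\<phi> x) = x"
  proof
    fix x assume "x \<in> pair_classes m \<times> pair_classes n"
    then obtain G K H L where x: "x = ((iso_class G, iso_class (subgrp G K)), (iso_class H, iso_class (subgrp H L)))"
      and G: "fin_abelian m (G :: nat monoid)" "subgroup K G" and H: "fin_abelian n (H :: nat monoid)" "subgroup L H"
      unfolding pair_classes_def by blast
    have "card K dvd m" "card L dvd n"
      using group.lagrange[OF fin_abelianD(2)[OF G(1)] G(2)] group.lagrange[OF fin_abelianD(2)[OF H(1)] H(2)]
        fin_abelianD(4)[OF G(1)] fin_abelianD(4)[OF H(1)] by (metis Coset.order_def dvd_triv_right)+
    then show "?\<psi> (?\<phi> x) = x"
      using tors[OF G(1) _ H(1)] tors[OF fin_abelian_subgrp[OF G] _ fin_abelian_subgrp[OF H]]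
      by (simp add: x)
  qed
  show "?\<phi> ` (pair_classes m \<times> pair_classes n) \<subseteq> pair_classes (m * n)"
  proof
    fix y assume "y \<in> ?\<phi> ` (pair_classes m \<times> pair_classes n)"
    then obtain C C' D D' where y: "y = (class_prod C D, class_prod C' D')" "(C, C') \<in> pair_classes m" "(D, D') \<in> pair_classes n"
      by auto
    then obtain G K H L where C: "C = iso_class G" "C' = iso_class (subgrp G K)" "D = iso_class H" "D' = iso_class (subgrp H L)"
      and G: "fin_abelian m (G :: nat monoid)" "subgroup K G" and H: "fin_abelian n (H :: nat monoid)" "subgroup L H"
      unfolding pair_classes_def by blast
    note g = fin_abelianD[OF G(1)] and h = fin_abelianD[OF H(1)]
    have "y = (iso_class (G \<times>\<times> H), iso_class (subgrp (G \<times>\<times> H) (K \<times> L)))"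
      unfolding y C class_prod_iso_class[OF g(2,3) h(2,3)]
        class_prod_iso_class[OF finite_group_of_class(1,2)[OF G] finite_group_of_class(1,2)[OF H]] subgrp_DirProd ..
    then show "y \<in> pair_classes (m * n)"
      using pair_classes_memI[OF fin_abelian_DirProd[OF G(1) H(1)] DirProd_subgroups[OF g(2) G(2) h(2) H(2)]] by simp
  qed
  have key: "((class_torsion m C, class_torsion m C'), (class_torsion n C, class_torsion n C')) \<in> pair_classes m \<times> pair_classes n
      \<and> ?\<phi> (?\<psi> (C, C')) = (C, C')" if CC: "(C, C') \<in> pair_classes (m * n)" for C C'
  proof -
    obtain G K where C: "C = iso_class G" "C' = iso_class (subgrp G K)" and G: "fin_abelian (m * n) (G :: nat monoid)" "subgroup K G"
      using CC unfolding pair_classes_def by blast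
    note g = fin_abelianD[OF G(1)]
    note ks = fin_abelian_subgrp[OF G]
    have KG: "K \<subseteq> carrier G" using G(2) by (rule subgroup.subset)
    have tor: "subgroup (torsion k G) G" for k using subgroup_torsion[OF g(1)] .
    have ab: "fin_abelian m (subgrp G (torsion m G))" "fin_abelian n (subgrp G (torsion n G))"
      using fin_abelian_subgrp[OF G(1) tor] card_torsion[OF G(1) mn] by metis+
    have sub: "subgroup (K \<inter> torsion k G) (subgrp G (torsion k G))" for k
      unfolding subgrp_def
      by (intro group.subgroup_incl[OF g(2)] group.subgroups_Inter_pair[OF g(2)] tor G(2)) auto
    have ct: "class_torsion k C = iso_class (subgrp G (torsion k G))"
      "class_torsion k C' = iso_class (subgrp (subgrp G (torsion k G)) (K \<inter> torsion k G))" for k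
      unfolding C class_torsion_iso_class[OF G(1)] class_torsion_iso_class[OF ks] torsion_subgrp[OF KG] subgrp_subgrp
      by simp_all
    have mem: "(class_torsion m C, class_torsion m C') \<in> pair_classes m" "(class_torsion n C, class_torsion n C') \<in> pair_classes n"
      unfolding ct by (intro pair_classes_memI ab sub)+
    have ex: "x [^]\<^bsub>G\<^esub> (m * n) = \<one>\<^bsub>G\<^esub>" if "x \<in> carrier G" for x
      using exponent_fin_abelian[OF G(1) that] by simp
    have d: "subgrp A (torsion m A) \<times>\<times> subgrp A (torsion n A) \<cong> A \<and>
       class_prod (iso_class (subgrp A (torsion m A))) (iso_class (subgrp A (torsion n A))) = iso_class A"
      if A: "A = G \<or> A = subgrp G K" for A
    proof -
      have a: "comm_group A" "group A" "finite (carrier A)"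
        using A g fin_abelianD[OF ks] by auto
      have t: "group (subgrp A (torsion k A))" "finite (carrier (subgrp A (torsion k A)))" for k
        using group_subgrp[OF a(2) subgroup_torsion[OF a(1)]] a(3) by (auto simp: torsion_def)
      have *: "subgrp A (torsion m A) \<times>\<times> subgrp A (torsion n A) \<cong> A"
        by (rule torsion_decomposition[OF a(1) _ mn]) (use A ex KG in auto)
      show ?thesis
        using iso_class_cong[OF DirProd_group[OF t(1) t(1)] a(2) *] * unfolding class_prod_iso_class[OF t t] by simp
    qed
    have "?\<phi> (?\<psi> (C, C')) = (C, C')"
      using d[of G] d[of "subgrp G K"] unfolding C
      by (simp add: class_torsion_iso_class[OF G(1)] class_torsion_iso_class[OF ks])
    with mem show ?thesis by simp
  qed
  show "\<forall>y\<in>pair_classes (m * n). ?\<phi> (?\<psi> y) = y"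
  proof
    fix y assume y: "y \<in> pair_classes (m * n)"
    obtain C C' where "y = (C, C')" by (rule prod.exhaust)
    show "?\<phi> (?\<psi> y) = y" using key[THEN conjunct2, of C C'] y by (simp only: \<open>y = (C, C')\<close>)
  qed
  show "?\<psi> ` pair_classes (m * n) \<subseteq> pair_classes m \<times> pair_classes n"
  proof
    fix z assume "z \<in> ?\<psi> ` pair_classes (m * n)"
    then obtain y where y: "y \<in> pair_classes (m * n)" "z = ?\<psi> y" by (rule imageE)
    obtain C C' where "y = (C, C')" by (rule prod.exhaust)
    then show "z \<in> pair_classes m \<times> pair_classes n" using key[THEN conjunct1, of C C'] y
      by (simp only: prod.case)
  qed
qed

lemma subgroup_class_total_mult:
  "coprime m n \<Longrightarrow> subgroup_class_total (m * n) = subgroup_class_total m * subgroup_class_total n"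
  unfolding subgroup_class_total_eq_card
  using bij_betw_same_card[OF pair_classes_coprime_bij] by (metis card_cartesian_product)

section \<open>Cyclic groups\<close>

definition cyclic_class :: "nat \<Rightarrow> nat monoid set" where
  "cyclic_class n = iso_class (integer_mod_group n)"

lemma fin_abelian_integer_mod_group: "n > 0 \<Longrightarrow> fin_abelian n (integer_mod_group n)"
  by (simp add: fin_abelian_def carrier_integer_mod_group)

lemma generate_iso_integer_mod_group:
  assumes G: "group G" and a: "a \<in> carrier G" and n: "n > 0" "group.ord G a = n"
  shows "integer_mod_group n \<cong> subgrp G (generate G {a})"
proof -
  interpret group G by fact
  let ?f = "\<lambda>i::int. a [^]\<^bsub>G\<^esub> i"
  have mod: "?f (i mod int n) = ?f i" for i
    using int_pow_eq[OF a, of "i mod int n" i] n by (simp add: dvd_minus_mod)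
  have hom: "?f \<in> hom (integer_mod_group n) (subgrp G (generate G {a}))"
    using a by (auto simp: hom_def generate_pow mod int_pow_mult)
  have inj: "inj_on ?f (carrier (integer_mod_group n))"
  proof (rule inj_onI)
    fix i j assume ij: "i \<in> carrier (integer_mod_group n)" "j \<in> carrier (integer_mod_group n)" "?f i = ?f j"
    then have "int n dvd j - i" using int_pow_eq[OF a] n by auto
    then have "j mod int n = i mod int n" by (simp add: mod_eq_dvd_iff)
    then show "i = j" using ij n by (simp add: carrier_integer_mod_group)
  qed
  have "?f ` carrier (integer_mod_group n) = generate G {a}"
  proof (intro subset_antisym subsetI)
    fix x assume "x \<in> generate G {a}"
    then obtain i :: int where "x = ?f i" using a by (auto simp: generate_pow)
    then have "x = ?f (i mod int n)" by (simp add: mod)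
    then show "x \<in> ?f ` carrier (integer_mod_group n)" using n by (auto simp: carrier_integer_mod_group)
  qed (use hom in \<open>auto simp: hom_def\<close>)
  then show ?thesis using hom inj by (intro is_isoI[of ?f]) (auto simp: iso_def bij_betw_def)
qed

lemma iso_class_generate:
  assumes "group G" "a \<in> carrier G" "group.ord G a = n" "n > 0"
  shows "iso_class (subgrp G (generate G {a})) = cyclic_class n"
  unfolding cyclic_class_def
  using generate_iso_integer_mod_group[OF assms(1,2,4,3)] assms
  by (intro iso_class_cong[symmetric] group_subgrp group.generate_is_subgroup group_integer_mod_group) auto

lemma iso_class_cyclic:
  assumes G: "fin_abelian n G" and a: "a \<in> carrier G" "group.ord G a = n"
  shows "iso_class G = cyclic_class n"
proof -
  interpret comm_group G using G by (simp add: fin_abelian_def)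
  note g = fin_abelianD[OF G]
  have "generate G {a} = carrier G"
    using a g generate_pow_card[OF a(1)] generate_incl[of "{a}"]
    by (intro card_subset_eq) auto
  then have "subgrp G (generate G {a}) = G" by (simp add: subgrp_def)
  moreover have "n > 0" using g one_closed by (metis card_gt_0_iff empty_iff)
  ultimately show ?thesis using iso_class_generate[OF g(2) a] by simp
qed

lemma iso_class_trivial:
  assumes G: "fin_abelian 1 G"
  shows "iso_class G = cyclic_class 1"
proof -
  interpret comm_group G using G by (simp add: fin_abelian_def)
  show ?thesis by (rule iso_class_cyclic[OF G one_closed ord_id])
qed

lemma iso_class_prime:
  assumes p: "prime p" and G: "fin_abelian p G"
  shows "iso_class G = cyclic_class p"
proof -
  interpret comm_group G using G by (simp add: fin_abelian_def)
  note g = fin_abelianD[OF G]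
  have "\<not> carrier G \<subseteq> {\<one>\<^bsub>G\<^esub>}"
    using g prime_gt_1_nat[OF p] card_mono[of "{\<one>\<^bsub>G\<^esub>}" "carrier G"] by auto
  then obtain x where x: "x \<in> carrier G" "x \<noteq> \<one>\<^bsub>G\<^esub>" by auto
  then have "ord x dvd p" "ord x \<noteq> 1"
    using ord_dvd_group_order[OF x(1)] ord_eq_1[OF x(1)] g by (auto simp: Coset.order_def)
  then have "ord x = p" using p by (auto simp: prime_nat_iff)
  then show ?thesis by (rule iso_class_cyclic[OF G x(1)])
qed

lemma pair_classes_prime:
  assumes p: "prime p"
  shows "pair_classes p \<subseteq> {(cyclic_class p, cyclic_class 1), (cyclic_class p, cyclic_class p)}"
proof
  fix x assume "x \<in> pair_classes p"
  then obtain G K where x: "x = (iso_class G, iso_class (subgrp G K))" and G: "fin_abelian p (G :: nat monoid)" "subgroup K G"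
    unfolding pair_classes_def by blast
  have "card K dvd p"
    using group.lagrange[OF fin_abelianD(2)[OF G(1)] G(2)] fin_abelianD(4)[OF G(1)]
    by (metis Coset.order_def dvd_triv_right)
  then have "card K = 1 \<or> card K = p" using p by (auto simp: prime_nat_iff)
  then have "iso_class (subgrp G K) \<in> {cyclic_class 1, cyclic_class p}"
    using iso_class_trivial[of "subgrp G K"] iso_class_prime[OF p, of "subgrp G K"] fin_abelian_subgrp[OF G]
    by (elim disjE) simp_all
  then show "x \<in> {(cyclic_class p, cyclic_class 1), (cyclic_class p, cyclic_class p)}"
    using iso_class_prime[OF p G(1)] x by auto
qed

text \<open>The residue of n/d has order \<open>d\<close> in the integers modulo \<open>n\<close>
  and generates the required subgroup.\<close>

lemma cyclic_pair_class:
  assumes n: "n > 0" and d: "d dvd n"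
  shows "(cyclic_class n, cyclic_class d) \<in> pair_classes n"
proof -
  let ?G = "integer_mod_group n"
  interpret comm_group ?G by simp
  \<comment> \<open>Reduction modulo \<open>n\<close> matters for \<open>d = 1\<close>, where
    \<open>n div d = n\<close> lies outside the carrier.\<close>
  define a where "a = int (n div d) mod int n"
  obtain e where e: "n = d * e" using d by (auto elim: dvdE)
  have e0: "e > 0" "d > 0" using n e by auto
  have a: "a \<in> carrier ?G" using n by (auto simp: a_def carrier_integer_mod_group)
  have "a [^]\<^bsub>?G\<^esub> k = \<one>\<^bsub>?G\<^esub> \<longleftrightarrow> d dvd k" for k :: nat
  proof -
    have "a [^]\<^bsub>?G\<^esub> k = \<one>\<^bsub>?G\<^esub> \<longleftrightarrow> int (k * e) mod int n = 0"
      using e0 by (simp add: a_def e mod_mult_right_eq)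
    also have "\<dots> \<longleftrightarrow> d * e dvd k * e" unfolding e by (metis dvd_eq_mod_eq_0 int_dvd_int_iff)
    also have "\<dots> \<longleftrightarrow> d dvd k" using e0 by simp
    finally show ?thesis .
  qed
  then have ord: "ord a = d" using ord_unique[OF a] by blast
  have "subgroup (generate ?G {a}) ?G" using a by (intro generate_is_subgroup) auto
  then show ?thesis
    using pair_classes_memI[OF fin_abelian_integer_mod_group[OF n]]
      iso_class_generate[OF is_group a ord e0(2)] by (metis cyclic_class_def)
qed

lemma cyclic_class_inj: "m > 0 \<Longrightarrow> n > 0 \<Longrightarrow> cyclic_class m = cyclic_class n \<longleftrightarrow> m = n"
  using iso_class_eq_iff[of "integer_mod_group m" "integer_mod_group n"]
    iso_same_card[of "integer_mod_group m" "integer_mod_group n"]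
  by (auto simp: cyclic_class_def carrier_integer_mod_group)

lemma divisor_count_le_subgroup_class_total:
  assumes "n > 0"
  shows "divisor_count n \<le> subgroup_class_total n"
proof -
  have "inj_on (\<lambda>d. (cyclic_class n, cyclic_class d)) {d. d dvd n}"
    using assms by (auto simp: inj_on_def dvd_pos_nat cyclic_class_inj)
  then have "divisor_count n = card ((\<lambda>d. (cyclic_class n, cyclic_class d)) ` {d. d dvd n})"
    by (simp add: divisor_count_def card_image)
  also have "\<dots> \<le> card (pair_classes n)"
    using cyclic_pair_class[OF assms] finite_pair_classes by (intro card_mono) auto
  finally show ?thesis by (simp add: subgroup_class_total_eq_card)
qed

lemma subgroup_class_total_prime:
  assumes p: "prime p"
  shows "subgroup_class_total p = 2"
proof (rule antisym)
  have "card (pair_classes p) \<le> card {(cyclic_class p, cyclic_class 1), (cyclic_class p, cyclic_class p)}"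
    using pair_classes_prime[OF p] by (intro card_mono) auto
  also have "\<dots> \<le> 2" by (simp add: card_insert_if)
  finally show "subgroup_class_total p \<le> 2" by (simp add: subgroup_class_total_eq_card)
  have "real (divisor_count (p ^ 1)) = 2" using divisor_count_prime_power[OF p, of 1] by simp
  then show "2 \<le> subgroup_class_total p"
    using divisor_count_le_subgroup_class_total[of p] prime_gt_0_nat[OF p] by simp
qed

lemma subgroup_class_total_1: "subgroup_class_total 1 = 1"
proof -
  have "pair_classes 1 = {(cyclic_class 1, cyclic_class 1)}"
  proof (intro subset_antisym subsetI)
    fix x assume "x \<in> pair_classes 1"
    then obtain G K where x: "x = (iso_class G, iso_class (subgrp G K))" and G: "fin_abelian 1 (G :: nat monoid)" "subgroup K G"
      unfolding pair_classes_def by blast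
    have "card K dvd 1"
      using group.lagrange[OF fin_abelianD(2)[OF G(1)] G(2)] fin_abelianD(4)[OF G(1)]
      by (metis Coset.order_def dvd_triv_right)
    then show "x \<in> {(cyclic_class 1, cyclic_class 1)}"
      using iso_class_trivial[OF G(1)] iso_class_trivial[of "subgrp G K"] fin_abelian_subgrp[OF G] x by auto
  next
    fix x assume "x \<in> {(cyclic_class 1, cyclic_class 1)}"
    then show "x \<in> pair_classes 1" using cyclic_pair_class[of 1 1] by auto
  qed
  then show ?thesis by (simp only: subgroup_class_total_eq_card) simp
qed

section \<open>Abelian groups of prime power order\<close>

lemma (in group) subgroup_nat_pow_closed:
  "subgroup H G \<Longrightarrow> x \<in> H \<Longrightarrow> x [^] (n::nat) \<in> H"
  by (induction n) (auto simp: subgroup.one_closed subgroup.m_closed)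

text \<open>By Bezout 1 = u s + v t, so \<open>z\<close> is the product of a power of z^s and a
  power of z^t.\<close>

lemma (in group) subgroup_mem_coprime_powers:
  assumes M: "subgroup M G" and z: "z \<in> carrier G" "z [^] s \<in> M" "z [^] t \<in> M" and st: "coprime s (t::nat)"
  shows "z \<in> M"
proof -
  have "gcd (int s) (int t) = 1" using st by (metis coprime_iff_gcd_eq_1 coprime_int_iff)
  then obtain u v where uv: "u * int s + v * int t = 1"
    using bezout_int[of "int s" "int t"] by auto
  have pw: "z [^] (i * int n) = (z [^] n) [^] i" for i n
    using int_pow_pow[OF z(1), of "int n" i] by (simp add: int_pow_int mult.commute)
  have "z = z [^] (u * int s + v * int t)" using z uv by simp
  also have "\<dots> = (z [^] s) [^] u \<otimes> (z [^] t) [^] v"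
    unfolding int_pow_mult[OF z(1)] pw ..
  also have "\<dots> \<in> M"
    using subgroup_int_pow_closed[OF M] z M by (intro subgroup.m_closed) auto
  finally show ?thesis .
qed

text \<open>A cyclic subgroup of maximal order splits off: a subgroup \<open>H\<close> maximal among those
  meeting it trivially is a complement, since otherwise some \<open>z\<close> outside the product has
  \<open>z\<^sup>p \<in> H\<close>, and \<open>H\<close> could be enlarged by \<open>z\<close>.\<close>

lemma cyclic_complement:
  fixes G :: "'a monoid"
  assumes G: "comm_group G" "finite (carrier G)" and p: "prime p"
    and ex: "\<And>x. x \<in> carrier G \<Longrightarrow> x [^]\<^bsub>G\<^esub> (p ^ Suc m) = \<one>\<^bsub>G\<^esub>"
    and a: "a \<in> carrier G" "group.ord G a = p ^ Suc m"
  obtains H where "subgroup H G" "generate G {a} \<inter> H \<subseteq> {\<one>\<^bsub>G\<^esub>}" "generate G {a} <#>\<^bsub>G\<^esub> H = carrier G"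
proof -
  interpret comm_group G by fact
  define A where "A = generate G {a}"
  have A: "subgroup A G" using a unfolding A_def by (intro generate_is_subgroup) auto
  have Apow: "A = {a [^]\<^bsub>G\<^esub> k | k. k \<in> (UNIV :: nat set)}"
    unfolding A_def using generate_pow_on_finite_carrier[OF G(2) a(1)] .
  define \<H> where "\<H> = {H. subgroup H G \<and> A \<inter> H \<subseteq> {\<one>\<^bsub>G\<^esub>}}"
  have "\<H> \<subseteq> Pow (carrier G)" by (auto simp: \<H>_def dest: subgroup.subset)
  then have fin: "finite \<H>" using G(2) by (simp add: finite_subset)
  have "{\<one>\<^bsub>G\<^esub>} \<in> \<H>" using triv_subgroup by (auto simp: \<H>_def)
  then have "Max (card ` \<H>) \<in> card ` \<H>" using fin by (intro Max_in) auto
  then obtain H where H: "H \<in> \<H>" "card H = Max (card ` \<H>)" by auto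
  have max: "card H' \<le> card H" if "H' \<in> \<H>" for H' using fin that H(2) by simp
  have Hs: "subgroup H G" and AH: "A \<inter> H \<subseteq> {\<one>\<^bsub>G\<^esub>}" using H(1) by (auto simp: \<H>_def)
  define M where "M = A <#>\<^bsub>G\<^esub> H"
  have M: "subgroup M G" unfolding M_def by (rule mult_subgroups[OF A Hs])
  have c: "x \<in> carrier G" if "x \<in> A \<or> x \<in> H \<or> x \<in> M" for x
    using that A Hs M by (auto dest: subgroup.subset)
  have AM: "A \<subseteq> M" "H \<subseteq> M"
  proof -
    have "x \<otimes>\<^bsub>G\<^esub> \<one>\<^bsub>G\<^esub> \<in> M" if "x \<in> A" for x
      unfolding M_def set_mult_def using that subgroup.one_closed[OF Hs] by auto
    then show "A \<subseteq> M" using c by auto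
    have "\<one>\<^bsub>G\<^esub> \<otimes>\<^bsub>G\<^esub> x \<in> M" if "x \<in> H" for x
      unfolding M_def set_mult_def using that subgroup.one_closed[OF A] by blast
    then show "H \<subseteq> M" using c by auto
  qed
  have "carrier G \<subseteq> M"
  proof (rule ccontr)
    assume "\<not> carrier G \<subseteq> M"
    then obtain x where x: "x \<in> carrier G" "x \<notin> M" by auto
    \<comment> \<open>The least \<open>j\<close> is positive, and the power one step earlier is the
      element \<open>y\<close> below: it lies outside \<open>M\<close>, but its p-th power lies
      inside.\<close>
    define j where "j = (LEAST j. x [^]\<^bsub>G\<^esub> (p ^ j) \<in> M)"
    have exj: "x [^]\<^bsub>G\<^esub> (p ^ Suc m) \<in> M" using ex[OF x(1)] subgroup.one_closed[OF M] by simp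
    have j: "x [^]\<^bsub>G\<^esub> (p ^ j) \<in> M" unfolding j_def by (rule LeastI, rule exj)
    then have "j \<noteq> 0" using x by (cases "j = 0") auto
    then obtain i where i: "j = Suc i" by (cases j) auto
    define y where "y = x [^]\<^bsub>G\<^esub> (p ^ i)"
    have "y \<notin> M" unfolding y_def using not_less_Least[of i "\<lambda>j. x [^]\<^bsub>G\<^esub> (p ^ j) \<in> M"] i j_def by auto
    have y: "y \<in> carrier G" using x by (simp add: y_def)
    have "y [^]\<^bsub>G\<^esub> p \<in> M" using j x by (simp add: y_def i nat_pow_pow mult.commute)
    then obtain b h where bh: "y [^]\<^bsub>G\<^esub> p = b \<otimes>\<^bsub>G\<^esub> h" "b \<in> A" "h \<in> H" unfolding M_def set_mult_def by auto
    obtain k :: nat where k: "b = a [^]\<^bsub>G\<^esub> k" using bh(2) Apow by auto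
    \<comment> \<open>Maximality of the order of \<open>a\<close> enters here. Raising y^p to the
      power p^m gives 1, so b^(p^m) lies in both \<open>A\<close> and \<open>H\<close> and is
      trivial; this makes \<open>k\<close> divisible by \<open>p\<close>, and \<open>b\<close> a
      p-th power within \<open>A\<close>.\<close>
    have "\<one>\<^bsub>G\<^esub> = (y [^]\<^bsub>G\<^esub> p) [^]\<^bsub>G\<^esub> (p ^ m)" using ex[OF y] y by (simp add: nat_pow_pow)
    also have "\<dots> = b [^]\<^bsub>G\<^esub> (p ^ m) \<otimes>\<^bsub>G\<^esub> h [^]\<^bsub>G\<^esub> (p ^ m)"
      using bh c by (simp add: pow_mult_distrib m_comm)
    finally have "b [^]\<^bsub>G\<^esub> (p ^ m) = inv\<^bsub>G\<^esub> (h [^]\<^bsub>G\<^esub> (p ^ m))"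
      using bh c by (intro inv_equality[symmetric]) auto
    also have "\<dots> \<in> H" using subgroup_nat_pow_closed[OF Hs bh(3)] Hs by (simp add: subgroup.m_inv_closed)
    finally have "b [^]\<^bsub>G\<^esub> (p ^ m) = \<one>\<^bsub>G\<^esub>" using AH subgroup_nat_pow_closed[OF A bh(2)] by auto
    then have "p ^ Suc m dvd k * p ^ m" using a by (simp add: k nat_pow_pow pow_eq_id)
    then have "p dvd k" using prime_gt_0_nat[OF p] by simp
    then obtain k' where k': "k = p * k'" by (auto elim: dvdE)
    define b' where "b' = a [^]\<^bsub>G\<^esub> k'"
    have b': "b' \<in> A" by (auto simp: b'_def Apow)
    \<comment> \<open>Dividing \<open>y\<close> by a p-th root of \<open>b\<close> removes the
      \<open>A\<close>-component of its p-th power: z^p = h lies in \<open>H\<close>, while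
      \<open>z\<close> remains outside \<open>M\<close>.\<close>
    define z where "z = y \<otimes>\<^bsub>G\<^esub> inv\<^bsub>G\<^esub> b'"
    have z: "z \<in> carrier G" using y b' c by (simp add: z_def)
    have "z [^]\<^bsub>G\<^esub> p = y [^]\<^bsub>G\<^esub> p \<otimes>\<^bsub>G\<^esub> inv\<^bsub>G\<^esub> (b' [^]\<^bsub>G\<^esub> p)"
      using y b' c by (simp add: z_def pow_mult_distrib m_comm nat_pow_inv)
    also have "b' [^]\<^bsub>G\<^esub> p = b" using a by (simp add: b'_def k k' nat_pow_pow mult.commute)
    also have "y [^]\<^bsub>G\<^esub> p \<otimes>\<^bsub>G\<^esub> inv\<^bsub>G\<^esub> b = h" using bh c by (metis inv_solve_right m_closed m_comm)
    finally have zp: "z [^]\<^bsub>G\<^esub> p = h" .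
    have zM: "z \<notin> M"
    proof
      assume "z \<in> M"
      then have "z \<otimes>\<^bsub>G\<^esub> b' \<in> M" using b' AM by (intro subgroup.m_closed[OF M]) auto
      then show False using \<open>y \<notin> M\<close> y b' c by (simp add: z_def m_assoc)
    qed
    define H' where "H' = H <#>\<^bsub>G\<^esub> generate G {z}"
    have H': "subgroup H' G" unfolding H'_def using z by (intro mult_subgroups Hs generate_is_subgroup) auto
    have Zpow: "generate G {z} = {z [^]\<^bsub>G\<^esub> k | k. k \<in> (UNIV :: nat set)}"
      using generate_pow_on_finite_carrier[OF G(2) z] .
    have "x \<otimes>\<^bsub>G\<^esub> \<one>\<^bsub>G\<^esub> \<in> H'" if "x \<in> H" for x
      unfolding H'_def set_mult_def using that generate.one[of G "{z}"] by blast
    then have "H \<subseteq> H'" using c by auto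
    moreover have "\<one>\<^bsub>G\<^esub> \<otimes>\<^bsub>G\<^esub> z \<in> H'"
      unfolding H'_def set_mult_def using subgroup.one_closed[OF Hs] generate.incl[of z "{z}" G] by blast
    then have "z \<in> H'" using z by simp
    moreover have "z \<notin> H" using zM AM by auto
    ultimately have "H \<subset> H'" by auto
    moreover have "finite H'" using subgroup.subset[OF H'] G(2) by (rule finite_subset)
    ultimately have "card H < card H'" by (intro psubset_card_mono)
    then have "H' \<notin> \<H>" using max by fastforce
    then obtain d where d: "d \<in> A" "d \<in> H'" "d \<noteq> \<one>\<^bsub>G\<^esub>" using H' by (auto simp: \<H>_def)
    then obtain u and t :: nat where u: "u \<in> H" "d = u \<otimes>\<^bsub>G\<^esub> z [^]\<^bsub>G\<^esub> t"
      unfolding H'_def set_mult_def Zpow by auto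
    \<comment> \<open>If \<open>p\<close> divides \<open>t\<close>, then z^t is a power of
      \<open>h\<close> and \<open>d\<close> falls into \<open>H\<close>. Otherwise z^t and z^p are
      coprime powers of \<open>z\<close> in \<open>M\<close>, which puts \<open>z\<close> itself in
      \<open>M\<close>.\<close>
    show False
    proof (cases "p dvd t")
      case True
      then obtain t' where "t = p * t'" by (auto elim: dvdE)
      then have "z [^]\<^bsub>G\<^esub> t = h [^]\<^bsub>G\<^esub> t'" using z by (simp add: nat_pow_pow flip: zp)
      then have "d \<in> H" using u subgroup_nat_pow_closed[OF Hs bh(3)] by (simp add: subgroup.m_closed[OF Hs])
      then show False using d AH by auto
    next
      case False
      then have "coprime t p" using p by (simp add: prime_imp_coprime_nat coprime_commute)
      moreover have eq: "z [^]\<^bsub>G\<^esub> t = inv\<^bsub>G\<^esub> u \<otimes>\<^bsub>G\<^esub> d" using u z c by (simp add: m_assoc[symmetric])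
      have "z [^]\<^bsub>G\<^esub> t \<in> M"
        unfolding eq using u(1) d(1) AM
        by (intro subgroup.m_closed[OF M] subgroup.m_inv_closed[OF M]) auto
      moreover have "z [^]\<^bsub>G\<^esub> p \<in> M" using zp bh AM by auto
      ultimately have "z \<in> M" using subgroup_mem_coprime_powers[OF M z] by blast
      then show False using zM by simp
    qed
  qed
  then have "M = carrier G" using c by auto
  then show thesis using that[OF Hs] AH unfolding A_def M_def by blast
qed

section \<open>The partition recursion for classes of bounded exponent\<close>

text \<open>The bound p^m on the exponent plays the part of a bound on the largest part: for a prime
  \<open>p\<close> these classes correspond to the partitions of \<open>k\<close> into parts at most
  \<open>m\<close>.\<close>

definition exponent_classes :: "nat \<Rightarrow> nat \<Rightarrow> nat \<Rightarrow> nat monoid set set" where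
  "exponent_classes p k m = {iso_class G | G :: nat monoid.
     fin_abelian (p ^ k) G \<and> (\<forall>x\<in>carrier G. x [^]\<^bsub>G\<^esub> (p ^ m) = \<one>\<^bsub>G\<^esub>)}"

lemma exponent_classes_subset: "exponent_classes p k m \<subseteq> abelian_classes (p ^ k)"
  by (auto simp: exponent_classes_def abelian_classes_def)

lemma finite_exponent_classes [simp]: "finite (exponent_classes p k m)"
  using exponent_classes_subset finite_abelian_classes by (rule finite_subset)

lemma abelian_classes_prime_power: "abelian_classes (p ^ k) = exponent_classes p k k"
proof (rule subset_antisym[OF _ exponent_classes_subset])
  show "abelian_classes (p ^ k) \<subseteq> exponent_classes p k k"
  proof
    fix c assume "c \<in> abelian_classes (p ^ k)"
    then obtain G :: "nat monoid" where c: "c = iso_class G" and G: "fin_abelian (p ^ k) G"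
      unfolding abelian_classes_def by blast
    have "\<forall>x\<in>carrier G. x [^]\<^bsub>G\<^esub> (p ^ k) = \<one>\<^bsub>G\<^esub>"
      using exponent_fin_abelian[OF G _ dvd_refl] by (rule ballI)
    then show "c \<in> exponent_classes p k k"
      unfolding exponent_classes_def mem_Collect_eq using c G by (intro exI[of _ G] conjI)
  qed
qed

lemma exponent_classes_0: "prime p \<Longrightarrow> exponent_classes p k 0 \<subseteq> (if k = 0 then {cyclic_class 1} else {})"
proof
  fix c assume p: "prime p" and "c \<in> exponent_classes p k 0"
  then obtain G :: "nat monoid" where c: "c = iso_class G" and G: "fin_abelian (p ^ k) G"
    and ex: "\<And>x. x \<in> carrier G \<Longrightarrow> x [^]\<^bsub>G\<^esub> (p ^ 0) = \<one>\<^bsub>G\<^esub>"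
    unfolding exponent_classes_def by blast
  interpret comm_group G using G by (simp add: fin_abelian_def)
  have "carrier G = {\<one>\<^bsub>G\<^esub>}" using ex one_closed by force
  then have "p ^ k = 1" using fin_abelianD(4)[OF G] by simp
  then have "k = 0" using prime_gt_1_nat[OF p] by simp
  then show "c \<in> (if k = 0 then {cyclic_class 1} else {})"
    using iso_class_trivial[of G] G c by simp
qed

text \<open>Either no part equals m + 1, or one such part is removed. It is a cyclic factor
  generated by an element not killed by p^m, whose order is therefore maximal. The complement may
  contain further factors of that size, so its exponent bound stays at m + 1.\<close>

lemma exponent_classes_Suc:
  assumes p: "prime p"
  shows "exponent_classes p k (Suc m) \<subseteq> exponent_classes p k m \<union>
    (if Suc m \<le> k then class_prod (cyclic_class (p ^ Suc m)) ` exponent_classes p (k - Suc m) (Suc m) else {})"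
    (is "_ \<subseteq> _ \<union> ?R")
proof
  fix c assume "c \<in> exponent_classes p k (Suc m)"
  then obtain G :: "nat monoid" where c: "c = iso_class G" and G: "fin_abelian (p ^ k) G"
    and ex: "\<And>x. x \<in> carrier G \<Longrightarrow> x [^]\<^bsub>G\<^esub> (p ^ Suc m) = \<one>\<^bsub>G\<^esub>"
    unfolding exponent_classes_def by blast
  interpret comm_group G using G by (simp add: fin_abelian_def)
  note g = fin_abelianD[OF G]
  show "c \<in> exponent_classes p k m \<union> ?R"
  proof (cases "\<forall>x\<in>carrier G. x [^]\<^bsub>G\<^esub> (p ^ m) = \<one>\<^bsub>G\<^esub>")
    case True
    then have "c \<in> exponent_classes p k m" unfolding exponent_classes_def c using G by blast
    then show ?thesis by (rule UnI1)
  next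
    case False
    then obtain a where a: "a \<in> carrier G" "a [^]\<^bsub>G\<^esub> (p ^ m) \<noteq> \<one>\<^bsub>G\<^esub>" by blast
    have "ord a dvd p ^ Suc m" using ex[OF a(1)] a by (simp only: pow_eq_id)
    then obtain i where i: "i \<le> Suc m" "ord a = p ^ i" 
      using divides_primepow_nat[OF p] by blast
    have "i = Suc m"
    proof (rule ccontr)
      assume "i \<noteq> Suc m"
      then have "ord a dvd p ^ m" using i by (simp add: le_imp_power_dvd)
      then show False using a by (simp add: pow_eq_id)
    qed
    then have o: "ord a = p ^ Suc m" using i by simp
    obtain H where H: "subgroup H G" "generate G {a} \<inter> H \<subseteq> {\<one>\<^bsub>G\<^esub>}" "generate G {a} <#>\<^bsub>G\<^esub> H = carrier G"
      using cyclic_complement[OF g(1,3) p ex a(1) o] by blast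
    define A where "A = generate G {a}"
    have A: "subgroup A G" using a unfolding A_def by (intro generate_is_subgroup) auto
    have "subgrp G A \<times>\<times> subgrp G H \<cong> G"
    proof (rule internal_DirProd[OF g(1) A H(1)])
      show "A \<inter> H \<subseteq> {\<one>\<^bsub>G\<^esub>}" using H(2) by (simp only: A_def)
      show "\<exists>u\<in>A. \<exists>h\<in>H. x = u \<otimes>\<^bsub>G\<^esub> h" if "x \<in> carrier G" for x
        using that unfolding A_def H(3)[symmetric] set_mult_def by blast
    qed
    note iso = this
    note AH = fin_abelian_subgrp[OF G A] fin_abelian_subgrp[OF G H(1)]
    have "c = iso_class (subgrp G A \<times>\<times> subgrp G H)"
      unfolding c
      by (rule iso_class_cong[OF _ _ iso, symmetric]) (intro DirProd_group fin_abelianD(2)[OF AH(1)] fin_abelianD(2)[OF AH(2)] g(2))+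
    also have "\<dots> = class_prod (iso_class (subgrp G A)) (iso_class (subgrp G H))"
      using fin_abelianD[OF AH(1)] fin_abelianD[OF AH(2)] by (intro class_prod_iso_class[symmetric])
    also have "iso_class (subgrp G A) = cyclic_class (p ^ Suc m)"
      unfolding A_def using prime_gt_0_nat[OF p] by (intro iso_class_generate[OF g(2) a(1) o]) simp
    finally have ceq: "c = class_prod (cyclic_class (p ^ Suc m)) (iso_class (subgrp G H))" .
    have cA: "card A = p ^ Suc m" using generate_pow_card[OF a(1)] o by (simp add: A_def)
    have cc: "p ^ k = p ^ Suc m * card H"
      using iso_same_card[OF iso] cA g(4) by (simp add: card_cartesian_product)
    then have k: "Suc m \<le> k" using prime_gt_1_nat[OF p] by (metis dvd_triv_left power_dvd_imp_le)
    then have "p ^ k = p ^ Suc m * p ^ (k - Suc m)" by (metis le_add_diff_inverse power_add)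
    then have "card H = p ^ (k - Suc m)" using cc prime_gt_0_nat[OF p] by simp
    then have "fin_abelian (p ^ (k - Suc m)) (subgrp G H)" using AH(2) by simp
    moreover have "\<forall>x\<in>carrier (subgrp G H). x [^]\<^bsub>subgrp G H\<^esub> (p ^ Suc m) = \<one>\<^bsub>subgrp G H\<^esub>"
    proof
      fix x assume "x \<in> carrier (subgrp G H)"
      then have "x \<in> carrier G" using subgroup.subset[OF H(1)] by auto
      then show "x [^]\<^bsub>subgrp G H\<^esub> (p ^ Suc m) = \<one>\<^bsub>subgrp G H\<^esub>"
        unfolding nat_pow_subgrp subgrp_simps by (rule ex)
    qed
    ultimately have "iso_class (subgrp G H) \<in> exponent_classes p (k - Suc m) (Suc m)"
      unfolding exponent_classes_def by blast
    then have "c \<in> class_prod (cyclic_class (p ^ Suc m)) ` exponent_classes p (k - Suc m) (Suc m)"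
      unfolding ceq by (rule imageI)
    then show ?thesis using k by (simp only: if_True UnI2)
  qed
qed

text \<open>The weights \<open>(3/4)\<^sup>k\<close> turn the recursion above into the bound by the partial products
  of the generating function of partitions at \<open>3/4\<close>.\<close>

lemma card_exponent_classes:
  assumes p: "prime p"
  shows "real (card (exponent_classes p k m)) * (3/4) ^ k \<le> (\<Prod>i=1..m. 1 / (1 - (3/4) ^ i))"
proof (induction m arbitrary: k)
  case 0
  have "card (exponent_classes p k 0) \<le> card (if k = 0 then {cyclic_class 1} else {})"
    by (intro card_mono exponent_classes_0[OF p]) auto
  then show ?case by (cases "k = 0") (auto split: if_splits)
next
  case (Suc m)
  define B where "B n = (\<Prod>i=1..n. 1 / (1 - (3/4 :: real) ^ i))" for n
  define y where "y = (3/4 :: real) ^ Suc m"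
  have y: "0 < y" "y < 1" unfolding y_def by (simp, rule power_Suc_less_one) auto
  \<comment> \<open>The induction step requires B m + y B (m + 1) \<le> B (m + 1); this identity
    turns it into an equality.\<close>
  have B: "B (Suc m) * (1 - y) = B m"
    using y by (simp add: B_def y_def prod.nat_ivl_Suc' del: power_Suc)
  have B0: "B n \<ge> 0" for n unfolding B_def by (intro prod_nonneg) (auto simp: power_le_one)
  \<comment> \<open>The second term of the recursion keeps \<open>m\<close> and lowers
    \<open>k\<close>, which calls for an inner strong induction on \<open>k\<close>.\<close>
  have "real (card (exponent_classes p k (Suc m))) * (3/4) ^ k \<le> B (Suc m)"
  proof (induction k rule: less_induct)
    case (less k)
    define R where "R = (if Suc m \<le> k then class_prod (cyclic_class (p ^ Suc m)) ` exponent_classes p (k - Suc m) (Suc m) else {})"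
    have "card (exponent_classes p k (Suc m)) \<le> card (exponent_classes p k m \<union> R)"
      unfolding R_def by (intro card_mono exponent_classes_Suc[OF p]) auto
    also have "\<dots> \<le> card (exponent_classes p k m) + card R" by (rule card_Un_le)
    finally have "real (card (exponent_classes p k (Suc m))) * (3/4) ^ k \<le>
        (real (card (exponent_classes p k m)) + real (card R)) * (3/4) ^ k"
      by (intro mult_right_mono) auto
    also have "\<dots> = real (card (exponent_classes p k m)) * (3/4) ^ k + real (card R) * (3/4) ^ k"
      by (rule distrib_right)
    also have "real (card (exponent_classes p k m)) * (3/4) ^ k \<le> B m"
      using Suc.IH unfolding B_def .
    also have "real (card R) * (3/4) ^ k \<le> y * B (Suc m)"
    proof (cases "Suc m \<le> k")
      case True
      have "card R \<le> card (exponent_classes p (k - Suc m) (Suc m))"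
        using True by (simp add: R_def card_image_le)
      then have "real (card R) * (3/4) ^ k \<le> real (card (exponent_classes p (k - Suc m) (Suc m))) * (3/4) ^ k"
        by (intro mult_right_mono) auto
      also have "\<dots> = real (card (exponent_classes p (k - Suc m) (Suc m))) * (3/4) ^ (k - Suc m) * y"
        unfolding y_def mult.assoc power_add[symmetric] using True by simp
      also have "\<dots> \<le> B (Suc m) * y"
        using True y by (intro mult_right_mono less.IH) auto
      finally show ?thesis by (simp add: mult.commute)
    qed (use y B0 in \<open>simp add: R_def\<close>)
    finally show ?case using B by (simp add: algebra_simps)
  qed
  then show ?case unfolding B_def .
qed

text \<open>For y \<le> 3/4 one has 1/(1 - y) \<le> 1 + 4y \<le> exp (4y), and the exponents 4
  (3/4)^i over all i \<ge> 1 add up to 12.\<close>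

lemma partition_product_le: "(\<Prod>i=1..m. 1 / (1 - (3/4 :: real) ^ i)) \<le> exp 12"
proof -
  have "(\<Prod>i=1..m. 1 / (1 - (3/4 :: real) ^ i)) \<le> (\<Prod>i=1..m. exp (4 * (3/4) ^ i))"
  proof (rule prod_mono)
    fix i assume "i \<in> {1..m}"
    define y where "y = (3/4 :: real) ^ i"
    have y: "0 < y" "y \<le> 3/4"
      using \<open>i \<in> {1..m}\<close> power_decreasing[of 1 i "3/4 :: real"] by (auto simp: y_def)
    have "1 / (1 - y) = 1 + y / (1 - y)" using y by (simp add: field_simps)
    also have "\<dots> \<le> 1 + 4 * y" using y by (simp add: field_simps)
    also have "\<dots> \<le> exp (4 * y)" by (rule exp_ge_add_one_self)
    finally have "1 / (1 - y) \<le> exp (4 * y)" .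
    then show "0 \<le> 1 / (1 - (3/4 :: real) ^ i) \<and> 1 / (1 - (3/4 :: real) ^ i) \<le> exp (4 * (3/4) ^ i)"
      using y by (simp add: y_def)
  qed
  also have "\<dots> = exp (\<Sum>i=1..m. 4 * (3/4 :: real) ^ i)" by (simp add: exp_sum)
  also have "(\<Sum>i=1..m. 4 * (3/4 :: real) ^ i) = 12 * (1 - (3/4) ^ m)"
    by (induction m) (auto simp: algebra_simps)
  also have "exp \<dots> \<le> exp (12 :: real)" by simp
  finally show ?thesis by simp
qed

lemma card_abelian_classes_prime_power:
  assumes "prime p"
  shows "real (card (abelian_classes (p ^ k))) \<le> exp 12 * (4/3) ^ k"
proof -
  have "real (card (abelian_classes (p ^ k))) * (3/4) ^ k \<le> exp 12"
    unfolding abelian_classes_prime_power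
    using card_exponent_classes[OF assms] partition_product_le by (rule order.trans)
  then have "real (card (abelian_classes (p ^ k))) * (3/4) ^ k * (4/3) ^ k \<le> exp 12 * (4/3) ^ k"
    by (intro mult_right_mono) auto
  also have "real (card (abelian_classes (p ^ k))) * (3/4) ^ k * (4/3) ^ k = real (card (abelian_classes (p ^ k)))"
    by (simp add: mult.assoc flip: power_mult_distrib)
  finally show ?thesis .
qed

text \<open>A pair consists of a class of order p^k and one of order p^j with j \<le> k; that the
  second embeds into the first is given up. The rate 4/3 is thereby squared, the geometric sum over
  j costs the factor 4, and 24 = 12 + 12.\<close>

lemma subgroup_class_total_prime_power:
  assumes p: "prime p"
  shows "real (subgroup_class_total (p ^ k)) \<le> 4 * exp 24 * (16/9) ^ k"
proof -
  define N where "N j = abelian_classes (p ^ j)" for j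
  have N: "real (card (N j)) \<le> exp 12 * (4/3) ^ j" for j
    unfolding N_def by (rule card_abelian_classes_prime_power[OF p])
  have sub: "pair_classes (p ^ k) \<subseteq> N k \<times> (\<Union>j\<in>{..k}. N j)"
  proof
    fix x assume "x \<in> pair_classes (p ^ k)"
    then obtain G K where x: "x = (iso_class G, iso_class (subgrp G K))" and G: "fin_abelian (p ^ k) (G :: nat monoid)" "subgroup K G"
      unfolding pair_classes_def by blast
    have "card K dvd p ^ k"
      using group.lagrange[OF fin_abelianD(2)[OF G(1)] G(2)] fin_abelianD(4)[OF G(1)]
      by (metis Coset.order_def dvd_triv_right)
    then obtain j where "j \<le> k" "card K = p ^ j" using p by (auto simp: divides_primepow_nat)
    then have "iso_class (subgrp G K) \<in> N j" using abelian_classes_memI[OF fin_abelian_subgrp[OF G]] by (simp add: N_def)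
    then show "x \<in> N k \<times> (\<Union>j\<in>{..k}. N j)"
      using \<open>j \<le> k\<close> abelian_classes_memI[OF G(1)] by (auto simp: x N_def)
  qed
  have "real (card (\<Union>j\<in>{..k}. N j)) \<le> (\<Sum>j\<le>k. real (card (N j)))"
    using card_UN_le[of "{..k}" N] by (simp flip: of_nat_sum)
  also have "\<dots> \<le> (\<Sum>j\<le>k. exp 12 * (4/3) ^ j)" by (intro sum_mono N)
  also have "\<dots> = exp 12 * (\<Sum>j\<le>k. (4/3) ^ j)" by (simp add: sum_distrib_left)
  also have "(\<Sum>j\<le>k. (4/3) ^ j) \<le> 4 * (4/3 :: real) ^ k" by (induction k) auto
  finally have U: "real (card (\<Union>j\<in>{..k}. N j)) \<le> exp 12 * (4 * (4/3) ^ k)" by simp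
  have "card (pair_classes (p ^ k)) \<le> card (N k \<times> (\<Union>j\<in>{..k}. N j))"
    using sub by (intro card_mono) (auto simp: N_def finite_abelian_classes)
  then have "real (subgroup_class_total (p ^ k)) \<le> real (card (N k)) * real (card (\<Union>j\<in>{..k}. N j))"
    by (simp add: subgroup_class_total_eq_card card_cartesian_product flip: of_nat_mult)
  also have "\<dots> \<le> (exp 12 * (4/3) ^ k) * (exp 12 * (4 * (4/3) ^ k))"
    using N U by (intro mult_mono) auto
  also have "\<dots> = 4 * (exp 12 * exp 12) * ((4/3) ^ k * (4/3) ^ k)" by simp
  also have "exp 12 * exp 12 = exp (24 :: real)" by (simp flip: exp_add)
  also have "(4/3 :: real) ^ k * (4/3) ^ k = (16/9) ^ k" by (simp flip: power_mult_distrib)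
  finally show ?thesis .
qed

lemma multiplicative_subgroup_class_total: "multiplicative (\<lambda>n. real (subgroup_class_total n))"
  by (simp add: multiplicative_def subgroup_class_total_mult subgroup_class_total_1[simplified])

theorem corollary4:
  shows "\<exists>C::real. (\<lambda>x::real. \<Sum>n\<in>{1..nat \<lfloor>x\<rfloor>}. real (subgroup_class_total n)) \<sim>[at_top] (\<lambda>x. C * x * ln x)"
proof (rule multiplicative_summatory_asymp_equiv[OF multiplicative_subgroup_class_total, where B = "4 * exp 24"])
  fix p k :: nat assume p: "prime p"
  then show "real (subgroup_class_total p) = 2" by (simp add: subgroup_class_total_prime)
  show "\<bar>real (subgroup_class_total (p ^ k))\<bar> \<le> 4 * exp 24 * (16/9) ^ k"
    using subgroup_class_total_prime_power[OF p] by simp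
qed (simp add: divisor_count_le_subgroup_class_total)

end
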